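(* Let $M,N\in\mathbb{Z}$ and let $D_{M,N}$ be the quantum d-bar operator $D$ of the noncommutative cylinder, acting in the Hilbert space $\mathcal{H}$, with domain $$\mathrm{dom}(D_{M,N})=\{a\in \mathrm{Dom}(D) : r_+(a)\in \mathrm{Ran}\,P_N^+,\ r_-(a)\in\mathrm{Ran}\,P_M^-\}.$$ Then $D_{M,N}$ is an unbounded Fredholm operator with index $\mathrm{ind}(D_{M,N})=M+N+1$. In fact, there is a bounded operator $Q_{M,N}$ on $\mathcal{H}$ such that $\mathrm{Ker}(Q_{M,N})=\mathrm{Coker}(D_{M,N})$, $D_{M,N}Q_{M,N}=I-\mathrm{Proj}_{\mathrm{Coker}(D_{M,N})}$, and $Q_{M,N}D_{M,N}=I-\mathrm{Proj}_{\mathrm{Ker}(D_{M,N})}$ (on $\mathrm{dom}(D_{M,N})$). Moreover $Q_{M,N}$ is a compact operator.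
   Context: Setting (noncommutative cylinder/annulus). Let $\{e_k\}_{k\in\mathbb{Z}}$ be the canonical orthonormal basis of $\ell^2(\mathbb{Z})$ and let $\{w_k\}_{k\in\mathbb{Z}}$ be a bounded sequence of positive numbers. Put $U_We_k=w_ke_{k+1}$ (bilateral weighted shift), $Ue_k=e_{k+1}$, and $S=[U_W^*,U_W]=U_W^*U_W-U_WU_W^*$, so $Se_k=s_ke_k$ with $s_k=w_k^2-w_{k-1}^2$. Standing assumptions: (1) there is $\epsilon>0$ with $w_k\ge\epsilon$ for all $k$; (2) $S\ge 0$; (3) $S$ is injective. (So $w_k$ is strictly increasing and $S$ is trace class.) Hilbert space. Let $C^*(W)$ be the $C^*$-algebra generated by $U_W$, and let $\mathcal{H}$ be its completion with respect to the inner product $\langle a,b\rangle_S=\mathrm{tr}(S^{1/2}bS^{1/2}a^* )$. Concretely, elements of $\mathcal{H}$ are the matrices $(a_{ij})_{i,j\in\mathbb{Z}}$ with $\sum_{i,j}s_i^{1/2}s_j^{1/2}|a_{ij}|^2<\infty$. Operator $D$. $Da=S^{-1/2}[a,U_W]S^{-1/2}$ (computed entrywise on matrices), with domain $\mathrm{Dom}(D)$ the set of $a\in\mathcal{H}$ for which $S^{1/2}(Da)S^{1/2}(Da)^*$ is trace class, i.e. $Da\in\mathcal{H}$. Fourier expansion and boundary maps. For a function $f$ on $\mathbb{Z}$ let $f(K)$ be the diagonal operator $f(K)e_k=f(k)e_k$. Every $a\in\mathcal{H}$ has a unique expansion $a=\sum_{m=0}^\infty U^mf_m(K)+\sum_{n=1}^\infty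 g_n(K)(U^* )^n$. For $a\in\mathrm{Dom}(D)$ the limits $f_m(\pm\infty)=\lim_{k\to\pm\infty}f_m(k)$ and $g_n(\pm\infty)=\lim_{k\to\pm\infty}g_n(k)$ exist, and the boundary restrictions are $$r_\pm(a)=\sum_{m=0}^\infty f_m(\pm\infty)e^{im\varphi}+\sum_{n=1}^\infty g_n(\pm\infty)e^{-in\varphi}$$ (they extend the quotient map $r=r_+\oplus r_-:C^*(W)\to C(S^1)\oplus C(S^1)$ by the compact operators, with $r_\pm(U)=e^{i\varphi}$). $P_N^\pm$ is the spectral projection in $L^2(S^1)$ of $\pm\frac1i\frac{\partial}{\partial\varphi}$ onto $(-\infty,N]$: $\mathrm{Ran}\,P_N^+$ is the closed span of $\{e^{in\varphi}\}_{n\le N}$ and $\mathrm{Ran}\,P_M^-$ is the closed span of $\{e^{in\varphi}\}_{n\ge -M}$. Thus the two boundary conditions mean that the coefficients of $e^{ij\varphi}$ in $r_+(a)$ vanish for $j>N$, and those in $r_-(a)$ vanish for $j<-M$. A (densely defined) unbounded operator is Fredholm if it is closed, has closed range, and has finite-dimensional kernel and cokernel; its index is $\dim\mathrm{Ker}-\dim\mathrm{Coker}$. $\mathrm{Coker}(D_{M,N})$ is identified with the orthogonal complement of the range of $D_{M,N}$, and $\mathrm{Proj}_V$ denotes orthogonal projection onto a closed subspace $V$. *)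

theory Defs
  imports "HOL-Analysis.Analysis" "HOL-Library.Function_Algebras"
begin

section \<open>Infinite matrices\<close>

text \<open>Operators on \<open>\<ell>\<^sup>2(\<int>)\<close> are represented by their matrices \<open>a i j = \<langle>e\<^sub>i, a e\<^sub>j\<rangle>\<close>. Addition,
  subtraction and \<open>0\<close> on matrices are the pointwise ones from
  \<open>HOL-Library.Function_Algebras\<close>; multiplication is \<open>mmul\<close>, never the pointwise \<open>*\<close>.\<close>

type_synonym mat = "int \<Rightarrow> int \<Rightarrow> complex"

definition mscale :: "complex \<Rightarrow> mat \<Rightarrow> mat" where
  "mscale c a = (\<lambda>i j. c * a i j)"

interpretation mat: vector_space mscale
  by unfold_locales (auto simp: mscale_def plus_fun_def algebra_simps)

definition mmul :: "mat \<Rightarrow> mat \<Rightarrow> mat" where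
  "mmul a b = (\<lambda>i j. \<Sum>\<^sub>\<infinity>k. a i k * b k j)"

definition madj :: "mat \<Rightarrow> mat" where
  "madj a = (\<lambda>i j. cnj (a j i))"

definition mdiag :: "(int \<Rightarrow> complex) \<Rightarrow> mat" where
  "mdiag f = (\<lambda>i j. if i = j then f j else 0)"

primrec mpow :: "mat \<Rightarrow> nat \<Rightarrow> mat" where
  "mpow a 0 = mdiag (\<lambda>_. 1)"
| "mpow a (Suc n) = mmul a (mpow a n)"

definition ell2 :: "(int \<Rightarrow> complex) set" where
  "ell2 = {x. (\<lambda>k. (cmod (x k))\<^sup>2) summable_on UNIV}"

definition ell2_inner :: "(int \<Rightarrow> complex) \<Rightarrow> (int \<Rightarrow> complex) \<Rightarrow> complex" where
  "ell2_inner x y = (\<Sum>\<^sub>\<infinity>k. cnj (x k) * y k)"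

definition mapply :: "mat \<Rightarrow> (int \<Rightarrow> complex) \<Rightarrow> (int \<Rightarrow> complex)" where
  "mapply a x = (\<lambda>i. \<Sum>\<^sub>\<infinity>k. a i k * x k)"

definition positive_op :: "mat \<Rightarrow> bool" where
  "positive_op a \<longleftrightarrow> (\<forall>x\<in>ell2. ell2_inner x (mapply a x) \<in> \<real>\<^sub>\<ge>\<^sub>0)"

definition injective_op :: "mat \<Rightarrow> bool" where
  "injective_op a \<longleftrightarrow> inj_on (mapply a) ell2"

section \<open>The weighted shift and the operator \<open>S\<close>\<close>

definition shiftU :: mat where
  "shiftU = (\<lambda>i j. if i = j + 1 then 1 else 0)"

definition UW :: "(int \<Rightarrow> real) \<Rightarrow> mat" where
  "UW w = (\<lambda>i j. if i = j + 1 then of_real (w j) else 0)"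

definition Sop :: "(int \<Rightarrow> real) \<Rightarrow> mat" where
  "Sop w = mmul (madj (UW w)) (UW w) - mmul (UW w) (madj (UW w))"

definition sval :: "(int \<Rightarrow> real) \<Rightarrow> int \<Rightarrow> real" where
  "sval w k = (w k)\<^sup>2 - (w (k - 1))\<^sup>2"

lemma infsum_singleton_support:
  assumes "\<And>k. k \<noteq> i \<Longrightarrow> f k = 0"
  shows "(\<Sum>\<^sub>\<infinity>k. f k) = (f i :: complex)"
proof -
  have "infsum f UNIV = infsum f {i}"
    by (rule infsum_cong_neutral) (use assms in auto)
  then show ?thesis by simp
qed

lemma mmul_mdiag_left: "mmul (mdiag f) a i j = f i * a i j"
  unfolding mmul_def mdiag_def by (subst infsum_singleton_support[where i = i]) auto

lemma mmul_mdiag_right: "mmul a (mdiag f) i j = a i j * f j"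
  unfolding mmul_def mdiag_def by (subst infsum_singleton_support[where i = j]) auto

lemma mmul_UW_right: "mmul a (UW w) i j = a i (j + 1) * of_real (w j)"
  unfolding mmul_def UW_def by (subst infsum_singleton_support[where i = "j + 1"]) auto

lemma mmul_UW_left: "mmul (UW w) a i j = of_real (w (i - 1)) * a (i - 1) j"
  unfolding mmul_def UW_def by (subst infsum_singleton_support[where i = "i - 1"]) auto

lemma Sop_eq_mdiag: "Sop w = mdiag (\<lambda>k. of_real (sval w k))"
proof (intro ext)
  fix i j
  show "Sop w i j = mdiag (\<lambda>k. of_real (sval w k)) i j"
    unfolding Sop_def fun_diff_def mmul_UW_left mmul_UW_right
    by (auto simp: madj_def UW_def mdiag_def sval_def power2_eq_square)
qed

text \<open>\<open>S\<close> is diagonal with entries \<open>sval w k\<close>, so under \<open>S \<ge> 0\<close> and \<open>S\<close> injective its real powers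
  are the diagonal matrices of the powers of its entries.\<close>

definition S_inv_half :: "(int \<Rightarrow> real) \<Rightarrow> mat" where
  "S_inv_half w = mdiag (\<lambda>k. of_real (1 / sqrt (sval w k)))"

section \<open>The Hilbert space\<close>

text \<open>\<open>hs_inner w a b\<close> is \<open>tr (S\<^sup>1\<^sup>/\<^sup>2 b S\<^sup>1\<^sup>/\<^sup>2 a\<^sup>*)\<close> written out in matrix entries; it is conjugate
  linear in \<open>a\<close> and linear in \<open>b\<close>.\<close>

definition HS :: "(int \<Rightarrow> real) \<Rightarrow> mat set" where
  "HS w = {a. (\<lambda>(i, j). sqrt (sval w i) * sqrt (sval w j) * (cmod (a i j))\<^sup>2) summable_on UNIV}"

definition hs_inner :: "(int \<Rightarrow> real) \<Rightarrow> mat \<Rightarrow> mat \<Rightarrow> complex" where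
  "hs_inner w a b =
     (\<Sum>\<^sub>\<infinity>(i, j). of_real (sqrt (sval w i)) * b i j * of_real (sqrt (sval w j)) * cnj (a i j))"

definition hs_norm :: "(int \<Rightarrow> real) \<Rightarrow> mat \<Rightarrow> real" where
  "hs_norm w a = sqrt (Re (hs_inner w a a))"

definition hs_top :: "(int \<Rightarrow> real) \<Rightarrow> mat topology" where
  "hs_top w = Metric_space.mtopology (HS w) (\<lambda>a b. hs_norm w (a - b))"

definition orth_compl :: "(int \<Rightarrow> real) \<Rightarrow> mat set \<Rightarrow> mat set" where
  "orth_compl w V = {b \<in> HS w. \<forall>a\<in>V. hs_inner w a b = 0}"

text \<open>Orthogonal projection onto \<open>V\<close>; meaningful for closed subspaces \<open>V\<close>.\<close>

definition orth_proj :: "(int \<Rightarrow> real) \<Rightarrow> mat set \<Rightarrow> mat \<Rightarrow> mat" where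
  "orth_proj w V a = (THE v. v \<in> V \<and> a - v \<in> orth_compl w V)"

section \<open>Operators in the Hilbert space\<close>

text \<open>An unbounded operator is given by its domain \<open>X\<close> and a function \<open>T\<close>, whose values outside \<open>X\<close>
  are irrelevant.\<close>

definition linear_between :: "mat set \<Rightarrow> mat set \<Rightarrow> (mat \<Rightarrow> mat) \<Rightarrow> bool" where
  "linear_between X Y T \<longleftrightarrow> mat.subspace X \<and> (\<forall>a\<in>X. T a \<in> Y) \<and>
     (\<forall>a\<in>X. \<forall>b\<in>X. T (a + b) = T a + T b) \<and> (\<forall>c. \<forall>a\<in>X. T (mscale c a) = mscale c (T a))"

definition unbounded_op :: "(int \<Rightarrow> real) \<Rightarrow> mat set \<Rightarrow> (mat \<Rightarrow> mat) \<Rightarrow> bool" where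
  "unbounded_op w X T \<longleftrightarrow> X \<subseteq> HS w \<and> linear_between X (HS w) T"

definition densely_defined :: "(int \<Rightarrow> real) \<Rightarrow> mat set \<Rightarrow> bool" where
  "densely_defined w X \<longleftrightarrow> hs_top w closure_of X = HS w"

definition closed_op :: "(int \<Rightarrow> real) \<Rightarrow> mat set \<Rightarrow> (mat \<Rightarrow> mat) \<Rightarrow> bool" where
  "closed_op w X T \<longleftrightarrow> closedin (prod_topology (hs_top w) (hs_top w)) ((\<lambda>a. (a, T a)) ` X)"

definition op_ker :: "mat set \<Rightarrow> (mat \<Rightarrow> mat) \<Rightarrow> mat set" where
  "op_ker X T = {a \<in> X. T a = 0}"

definition op_coker :: "(int \<Rightarrow> real) \<Rightarrow> mat set \<Rightarrow> (mat \<Rightarrow> mat) \<Rightarrow> mat set" where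
  "op_coker w X T = orth_compl w (T ` X)"

definition finite_dim :: "mat set \<Rightarrow> bool" where
  "finite_dim V \<longleftrightarrow> (\<exists>B. finite B \<and> mat.span B = V)"

definition fredholm_op :: "(int \<Rightarrow> real) \<Rightarrow> mat set \<Rightarrow> (mat \<Rightarrow> mat) \<Rightarrow> bool" where
  "fredholm_op w X T \<longleftrightarrow>
     unbounded_op w X T \<and> densely_defined w X \<and> closed_op w X T \<and>
     closedin (hs_top w) (T ` X) \<and>
     finite_dim (op_ker X T) \<and> finite_dim (op_coker w X T)"

definition op_index :: "(int \<Rightarrow> real) \<Rightarrow> mat set \<Rightarrow> (mat \<Rightarrow> mat) \<Rightarrow> int" where
  "op_index w X T = int (mat.dim (op_ker X T)) - int (mat.dim (op_coker w X T))"

definition bounded_op :: "(int \<Rightarrow> real) \<Rightarrow> (mat \<Rightarrow> mat) \<Rightarrow> bool" where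
  "bounded_op w Q \<longleftrightarrow> linear_between (HS w) (HS w) Q \<and>
     (\<exists>C. \<forall>a\<in>HS w. hs_norm w (Q a) \<le> C * hs_norm w a)"

definition compact_op :: "(int \<Rightarrow> real) \<Rightarrow> (mat \<Rightarrow> mat) \<Rightarrow> bool" where
  "compact_op w Q \<longleftrightarrow> linear_between (HS w) (HS w) Q \<and>
     compactin (hs_top w) (hs_top w closure_of (Q ` {a \<in> HS w. hs_norm w a \<le> 1}))"

section \<open>The quantum d-bar operator\<close>

definition Dop :: "(int \<Rightarrow> real) \<Rightarrow> mat \<Rightarrow> mat" where
  "Dop w a = mmul (S_inv_half w) (mmul (mmul a (UW w) - mmul (UW w) a) (S_inv_half w))"

definition DomD :: "(int \<Rightarrow> real) \<Rightarrow> mat set" where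
  "DomD w = {a \<in> HS w. Dop w a \<in> HS w}"

lemma Dop_entry:
  "Dop w a i j = (a i (j + 1) * of_real (w j) - of_real (w (i - 1)) * a (i - 1) j)
     / of_real (sqrt (sval w i) * sqrt (sval w j))"
  unfolding Dop_def S_inv_half_def mmul_mdiag_left mmul_mdiag_right fun_diff_def
    mmul_UW_left mmul_UW_right
  by simp

section \<open>Fourier expansion and boundary restrictions\<close>

text \<open>The coefficients \<open>f\<^sub>m\<close> and \<open>g\<^sub>n\<close> of \<open>a = \<Sum>\<^sub>m U\<^sup>m f\<^sub>m(K) + \<Sum>\<^sub>n g\<^sub>n(K) (U\<^sup>*)\<^sup>n\<close>, read off the
  diagonals of \<open>a\<close>; see the two lemmas below.\<close>

definition fcoef :: "mat \<Rightarrow> nat \<Rightarrow> int \<Rightarrow> complex" where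
  "fcoef a m k = a (k + int m) k"

definition gcoef :: "mat \<Rightarrow> nat \<Rightarrow> int \<Rightarrow> complex" where
  "gcoef a n k = a k (k + int n)"

lemma mpow_shiftU: "mpow shiftU m i j = (if i = j + int m then 1 else 0)"
proof (induction m arbitrary: i j)
  case 0
  then show ?case by (simp add: mdiag_def)
next
  case (Suc m)
  have "mpow shiftU (Suc m) i j = shiftU i (i - 1) * mpow shiftU m (i - 1) j"
    unfolding mpow.simps mmul_def
    by (rule infsum_singleton_support) (auto simp: shiftU_def)
  then show ?case using Suc.IH by (auto simp: shiftU_def)
qed

lemma mpow_madj_shiftU: "mpow (madj shiftU) n i j = (if j = i + int n then 1 else 0)"
proof (induction n arbitrary: i j)
  case 0
  then show ?case by (simp add: mdiag_def)
next
  case (Suc m)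
  have "mpow (madj shiftU) (Suc m) i j = madj shiftU i (i + 1) * mpow (madj shiftU) m (i + 1) j"
    unfolding mpow.simps mmul_def
    by (rule infsum_singleton_support) (auto simp: shiftU_def madj_def)
  then show ?case using Suc.IH by (auto simp: shiftU_def madj_def)
qed

lemma fourier_series_entry:
  "(\<Sum>\<^sub>\<infinity>m. mmul (mpow shiftU m) (mdiag (f m)) i j)
     + (\<Sum>\<^sub>\<infinity>n\<in>{1..}. mmul (mdiag (g n)) (mpow (madj shiftU) n) i j)
   = (if j \<le> i then f (nat (i - j)) j else g (nat (j - i)) i)"
proof -
  have 1: "(\<Sum>\<^sub>\<infinity>m. mmul (mpow shiftU m) (mdiag (f m)) i j)
      = (if j \<le> i then f (nat (i - j)) j else 0)"
  proof (cases "j \<le> i")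
    case True
    have "infsum (\<lambda>m. mmul (mpow shiftU m) (mdiag (f m)) i j) UNIV
        = infsum (\<lambda>m. mmul (mpow shiftU m) (mdiag (f m)) i j) {nat (i - j)}"
      by (rule infsum_cong_neutral) (auto simp: mmul_mdiag_right mpow_shiftU)
    with True show ?thesis by (simp add: mmul_mdiag_right mpow_shiftU)
  next
    case False
    then show ?thesis by (auto simp: mmul_mdiag_right mpow_shiftU intro!: infsum_0)
  qed
  have 2: "(\<Sum>\<^sub>\<infinity>n\<in>{1..}. mmul (mdiag (g n)) (mpow (madj shiftU) n) i j)
      = (if j \<le> i then 0 else g (nat (j - i)) i)"
  proof (cases "j \<le> i")
    case False
    have "infsum (\<lambda>n. mmul (mdiag (g n)) (mpow (madj shiftU) n) i j) {1..}
        = infsum (\<lambda>n. mmul (mdiag (g n)) (mpow (madj shiftU) n) i j) {nat (j - i)}"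
      using False by (intro infsum_cong_neutral) (auto simp: mmul_mdiag_left mpow_madj_shiftU)
    with False show ?thesis by (simp add: mmul_mdiag_left mpow_madj_shiftU)
  next
    case True
    then show ?thesis by (auto simp: mmul_mdiag_left mpow_madj_shiftU intro!: infsum_0)
  qed
  show ?thesis unfolding 1 2 by simp
qed

lemma fourier_expansion:
  "a i j = (\<Sum>\<^sub>\<infinity>m. mmul (mpow shiftU m) (mdiag (fcoef a m)) i j)
     + (\<Sum>\<^sub>\<infinity>n\<in>{1..}. mmul (mdiag (gcoef a n)) (mpow (madj shiftU) n) i j)"
  unfolding fourier_series_entry by (simp add: fcoef_def gcoef_def)

lemma fourier_expansion_unique:
  assumes "\<And>i j. a i j = (\<Sum>\<^sub>\<infinity>m. mmul (mpow shiftU m) (mdiag (f m)) i j)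
     + (\<Sum>\<^sub>\<infinity>n\<in>{1..}. mmul (mdiag (g n)) (mpow (madj shiftU) n) i j)"
  shows "f m = fcoef a m" and "n \<ge> 1 \<Longrightarrow> g n = gcoef a n"
  using assms unfolding fourier_series_entry by (auto simp: fcoef_def gcoef_def fun_eq_iff)

text \<open>Functions on the circle are represented by their sequences of Fourier coefficients: entry \<open>j\<close>
  is the coefficient of \<open>e\<^sup>i\<^sup>j\<^sup>\<phi>\<close>, and \<open>L\<^sup>2(S\<^sup>1)\<close> becomes \<open>\<ell>\<^sup>2(\<int>)\<close>. The limits exist for \<open>a\<close> in the
  domain of \<open>D\<close>.\<close>

definition r_plus :: "mat \<Rightarrow> int \<Rightarrow> complex" where
  "r_plus a j =
     (if j \<ge> 0 then Lim at_top (fcoef a (nat j)) else Lim at_top (gcoef a (nat (- j))))"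

definition r_minus :: "mat \<Rightarrow> int \<Rightarrow> complex" where
  "r_minus a j =
     (if j \<ge> 0 then Lim at_bot (fcoef a (nat j)) else Lim at_bot (gcoef a (nat (- j))))"

text \<open>Ranges of the spectral projections of \<open>\<plusminus>(1/i) \<partial>/\<partial>\<phi>\<close> onto \<open>(-\<infinity>, N]\<close>: the eigenvalue on
  \<open>e\<^sup>i\<^sup>j\<^sup>\<phi>\<close> is \<open>\<plusminus>j\<close>.\<close>

definition RanP_plus :: "int \<Rightarrow> (int \<Rightarrow> complex) set" where
  "RanP_plus N = {c \<in> ell2. \<forall>j. j > N \<longrightarrow> c j = 0}"

definition RanP_minus :: "int \<Rightarrow> (int \<Rightarrow> complex) set" where
  "RanP_minus M = {c \<in> ell2. \<forall>j. - j > M \<longrightarrow> c j = 0}"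

definition dom_DMN :: "(int \<Rightarrow> real) \<Rightarrow> int \<Rightarrow> int \<Rightarrow> mat set" where
  "dom_DMN w M N = {a \<in> DomD w. r_plus a \<in> RanP_plus N \<and> r_minus a \<in> RanP_minus M}"

end

theory Submission
  imports Defs
begin

text \<open>
  Sort the entries of a matrix by diagonals: the diagonal \<open>n\<close> of \<open>a\<close> is the sequence
  \<open>x k = a (k + n) k\<close>. The operator \<open>D\<close> sends it to the diagonal \<open>n + 1\<close> with entries
  \<open>(w k * x (k + 1) - w (k + n) * x k) / sqrt (s (k + n + 1) * s k)\<close>, so \<open>D a = y\<close> is a family of
  independent first order difference equations on \<open>\<int>\<close>, one for each \<open>n\<close>. The homogeneous equation
  is solved by the multiples of a positive sequence \<open>h n\<close>, which is bounded, bounded away from \<open>0\<close>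
  and has positive limits at both ends (\<open>h_bounds\<close>, \<open>h_lims\<close>). Writing \<open>x = h n * \<zeta>\<close> turns the
  inhomogeneous equation into \<open>\<zeta> (k + 1) - \<zeta> k = r k\<close> with a summable \<open>r\<close> depending linearly
  on \<open>y\<close>. Hence \<open>\<zeta>\<close> has limits at both ends, and these limits differ by \<open>\<Sum>k. r k\<close>.

  The boundary conditions ask \<open>x\<close> to vanish at \<open>+\<infinity>\<close> if \<open>n > N\<close> and at \<open>-\<infinity>\<close> if \<open>n < -M\<close>. A
  diagonal with exactly one condition has exactly one solution. A diagonal with no condition,
  \<open>-M \<le> n \<le> N\<close>, contributes \<open>h n\<close> to the kernel. A diagonal with two conditions, \<open>N < n < -M\<close>,
  is solvable only if \<open>\<Sum>k. r k = 0\<close>, which says that \<open>y\<close> is orthogonal to the matrix with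
  \<open>1 / h (n + 1)\<close> on its diagonal \<open>n + 1\<close>; it contributes one dimension to the cokernel. At least
  one of these two ranges of \<open>n\<close> is empty, and in every case the difference of their cardinalities is
  \<open>M + N + 1\<close>.

  For the analysis, let \<open>green y\<close> be the solution obtained by summing from \<open>+\<infinity>\<close> if \<open>n > N\<close> and
  from \<open>-\<infinity>\<close> otherwise. As \<open>w\<close> is increasing, \<open>h n\<close> is increasing for \<open>n \<ge> 0\<close> and decreasing for
  \<open>n \<le> 0\<close>, so outside a finite range of \<open>n\<close> the summation runs in the direction that keeps the
  ratios of the \<open>h\<close> below \<open>1 / \<epsilon>\<close>. Therefore each entry of \<open>green y\<close> on the diagonal \<open>n\<close> is at most
  a constant, the same for all \<open>n\<close>, times the weighted \<open>\<ell>\<^sup>1\<close> norm of \<open>y\<close> on the diagonal \<open>n + 1\<close>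
  (\<open>green_bound\<close>). Operators with such an estimate are called \<open>dominated\<close> here. Since
  \<open>\<Sum>k. s k\<close> is finite, they are bounded, and they are compact (\<open>dominated_compact\<close>): the unit ball
  is compact for entrywise convergence by Tychonoff's theorem, and on it a dominated operator is
  continuous from entrywise convergence to the norm.

  The orthogonal projections \<open>P\<^sub>K\<close> and \<open>P\<^sub>C\<close> onto the kernel and the cokernel are dominated as well, so
  \<open>Q = (1 - P\<^sub>K) green (1 - P\<^sub>C)\<close> is compact. The domain consists of the matrices \<open>green y + v\<close> with
  \<open>y\<close> orthogonal to the cokernel and \<open>v\<close> in the kernel (\<open>dom_eq_domT\<close>), and from this description
  closedness, closed range and the identities for \<open>Q\<close> follow by algebra (locale \<open>parametrix\<close>).
\<close>

section \<open>Sums and limits over the integers\<close>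

lemma finite_sums_le_imp_summable_on:
  fixes f :: "'a \<Rightarrow> real"
  assumes "\<And>x. x \<in> A \<Longrightarrow> 0 \<le> f x" "\<And>F. finite F \<Longrightarrow> F \<subseteq> A \<Longrightarrow> sum f F \<le> c"
  shows "f summable_on A" "infsum f A \<le> c"
proof -
  show s: "f summable_on A"
    using assms by (intro nonneg_bdd_above_summable_on bdd_aboveI2[where M = c]) auto
  show "infsum f A \<le> c"
    using s assms(2) by (rule infsum_le_finite_sums)
qed

lemma summable_on_weighted_cauchy_schwarz:
  fixes p x :: "'a \<Rightarrow> real"
  assumes p: "\<And>i. i \<in> A \<Longrightarrow> 0 \<le> p i" and x: "\<And>i. i \<in> A \<Longrightarrow> 0 \<le> x i"
    and sp: "p summable_on A" and sx: "(\<lambda>i. p i * (x i)\<^sup>2) summable_on A"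
  shows "(\<lambda>i. p i * x i) summable_on A"
    and "(\<Sum>\<^sub>\<infinity>i\<in>A. p i * x i)\<^sup>2 \<le> (\<Sum>\<^sub>\<infinity>i\<in>A. p i) * (\<Sum>\<^sub>\<infinity>i\<in>A. p i * (x i)\<^sup>2)"
proof -
  let ?c = "sqrt ((\<Sum>\<^sub>\<infinity>i\<in>A. p i) * (\<Sum>\<^sub>\<infinity>i\<in>A. p i * (x i)\<^sup>2))"
  have nn: "0 \<le> (\<Sum>\<^sub>\<infinity>i\<in>A. p i) * (\<Sum>\<^sub>\<infinity>i\<in>A. p i * (x i)\<^sup>2)"
    using p by (intro mult_nonneg_nonneg infsum_nonneg) auto
  have bound: "(\<Sum>i\<in>F. p i * x i) \<le> ?c" if F: "finite F" "F \<subseteq> A" for F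
  proof (rule real_le_rsqrt)
    have "(\<Sum>i\<in>F. p i * x i)\<^sup>2 = (\<Sum>i\<in>F. sqrt (p i) * (sqrt (p i) * x i))\<^sup>2"
      using F p by (intro arg_cong[where f = "\<lambda>t. t\<^sup>2"] sum.cong) (auto simp flip: mult.assoc)
    also have "\<dots> \<le> (\<Sum>i\<in>F. (sqrt (p i))\<^sup>2) * (\<Sum>i\<in>F. (sqrt (p i) * x i)\<^sup>2)"
      by (rule Cauchy_Schwarz_ineq_sum)
    also have "\<dots> = (\<Sum>i\<in>F. p i) * (\<Sum>i\<in>F. p i * (x i)\<^sup>2)"
      using F p by (intro arg_cong2[where f = "(*)"] sum.cong) (auto simp: power_mult_distrib)
    also have "\<dots> \<le> (\<Sum>\<^sub>\<infinity>i\<in>A. p i) * (\<Sum>\<^sub>\<infinity>i\<in>A. p i * (x i)\<^sup>2)"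
      using F p sp sx
      by (intro mult_mono finite_sum_le_infsum infsum_nonneg sum_nonneg) auto
    finally show "(\<Sum>i\<in>F. p i * x i)\<^sup>2 \<le> (\<Sum>\<^sub>\<infinity>i\<in>A. p i) * (\<Sum>\<^sub>\<infinity>i\<in>A. p i * (x i)\<^sup>2)" .
  qed
  have pos: "\<And>i. i \<in> A \<Longrightarrow> 0 \<le> p i * x i"
    using p x by simp
  show "(\<lambda>i. p i * x i) summable_on A"
    using pos bound by (rule finite_sums_le_imp_summable_on)
  have "(\<Sum>\<^sub>\<infinity>i\<in>A. p i * x i) \<le> ?c"
    using pos bound by (rule finite_sums_le_imp_summable_on)
  then show "(\<Sum>\<^sub>\<infinity>i\<in>A. p i * x i)\<^sup>2 \<le> (\<Sum>\<^sub>\<infinity>i\<in>A. p i) * (\<Sum>\<^sub>\<infinity>i\<in>A. p i * (x i)\<^sup>2)"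
    using pos infsum_nonneg[of A "\<lambda>i. p i * x i"] nn
    by (metis (no_types, lifting) power_mono real_sqrt_pow2)
qed

lemma infsum_abs_tail_small:
  fixes f :: "'a \<Rightarrow> 'b::real_normed_vector"
  assumes "f abs_summable_on A" "e > 0"
  obtains G where "finite G" "G \<subseteq> A" "(\<Sum>\<^sub>\<infinity>x\<in>A - G. norm (f x)) < e"
proof -
  obtain G where G: "finite G" "G \<subseteq> A"
      "dist (\<Sum>x\<in>G. norm (f x)) (\<Sum>\<^sub>\<infinity>x\<in>A. norm (f x)) \<le> e / 2"
    using infsum_finite_approximation[of "\<lambda>x. norm (f x)" A "e / 2"] assms by auto
  have "(\<Sum>\<^sub>\<infinity>x\<in>A - G. norm (f x)) = (\<Sum>\<^sub>\<infinity>x\<in>A. norm (f x)) - (\<Sum>\<^sub>\<infinity>x\<in>G. norm (f x))"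
    using assms(1) G(1,2) by (intro infsum_Diff) auto
  moreover have "(\<Sum>\<^sub>\<infinity>x\<in>G. norm (f x)) = (\<Sum>x\<in>G. norm (f x))"
    using G(1) by (rule infsum_finite)
  ultimately have "(\<Sum>\<^sub>\<infinity>x\<in>A - G. norm (f x)) < e"
    using G(3) \<open>e > 0\<close> unfolding dist_real_def by linarith
  then show thesis using G(1,2) that by blast
qed

text \<open>Tails of an absolutely summable family: the index sets \<open>S k\<close> need not be nested, it is enough that
  they eventually leave every single index behind.\<close>

lemma tendsto_infsum_escaping:
  fixes f :: "'a \<Rightarrow> 'b::banach"
  assumes f: "f abs_summable_on UNIV"
    and esc: "\<And>i. eventually (\<lambda>k. i \<notin> S k) F"
  shows "((\<lambda>k. infsum f (S k)) \<longlongrightarrow> 0) F"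
proof (rule tendstoI)
  fix e :: real assume "e > 0"
  then obtain G where G: "finite G" "(\<Sum>\<^sub>\<infinity>x\<in>UNIV - G. norm (f x)) < e"
    using infsum_abs_tail_small[OF f] by metis
  have "eventually (\<lambda>k. \<forall>i\<in>G. i \<notin> S k) F"
    using G(1) esc by (simp add: eventually_ball_finite)
  then show "eventually (\<lambda>k. dist (infsum f (S k)) 0 < e) F"
  proof (rule eventually_mono)
    fix k assume k: "\<forall>i\<in>G. i \<notin> S k"
    have sub: "(\<lambda>x. norm (f x)) summable_on B" for B
      using f by (rule summable_on_subset) auto
    have "norm (infsum f (S k)) \<le> (\<Sum>\<^sub>\<infinity>x\<in>S k. norm (f x))"
      using sub by (rule norm_infsum_bound)
    also have "\<dots> \<le> (\<Sum>\<^sub>\<infinity>x\<in>UNIV - G. norm (f x))"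
      using sub k by (intro infsum_mono2) auto
    finally show "dist (infsum f (S k)) 0 < e"
      using G(2) by simp
  qed
qed

lemma tendsto_SUP_at_top_int:
  fixes f :: "int \<Rightarrow> real"
  assumes "mono f" "\<And>k. f k \<le> c"
  shows "(f \<longlongrightarrow> (SUP k. f k)) at_top"
proof (rule order_tendstoI)
  have bdd: "bdd_above (range f)"
    using assms(2) by (intro bdd_aboveI2[where M = c]) auto
  fix a
  show "eventually (\<lambda>x. a < f x) at_top" if a: "a < (SUP k. f k)"
  proof -
    obtain k where "a < f k"
      using a less_cSUP_iff[OF UNIV_not_empty bdd, of a] by auto
    then show ?thesis
      unfolding eventually_at_top_linorder
      by (meson assms(1) monoD order_less_le_trans)
  qed
  show "eventually (\<lambda>x. f x < a) at_top" if "(SUP k. f k) < a"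
    using that cSUP_upper[OF UNIV_I bdd] by (intro always_eventually) (meson order_le_less_trans)
qed

lemma mono_int_has_limits:
  fixes f :: "int \<Rightarrow> real"
  assumes "mono f" "\<And>k. f k \<le> c" "\<And>k. b \<le> f k"
  obtains l1 l2 where "(f \<longlongrightarrow> l1) at_top" "(f \<longlongrightarrow> l2) at_bot"
proof -
  have "((\<lambda>k. - f (- k)) \<longlongrightarrow> (SUP k. - f (- k))) at_top"
    using assms(1,3) by (intro tendsto_SUP_at_top_int[where c = "- b"]) (auto simp: mono_def)
  then have "((\<lambda>k. - f (- k)) \<longlongrightarrow> (SUP k. - f (- k))) (filtermap uminus at_bot)"
    by (simp add: at_top_mirror)
  then have "((\<lambda>k. - f k) \<longlongrightarrow> (SUP k. - f (- k))) at_bot"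
    by (simp add: filterlim_filtermap)
  then have "(f \<longlongrightarrow> - (SUP k. - f (- k))) at_bot"
    using tendsto_minus_cancel_left by fastforce
  then show thesis
    using that tendsto_SUP_at_top_int[OF assms(1,2)] by blast
qed

text \<open>Summation over \<open>\<int> \<times> \<int>\<close> diagonal by diagonal, the diagonal \<open>m\<close> being \<open>{(k + m, k) | k. True}\<close>.
  All estimates below are made on single diagonals and then added up.\<close>

lemma bij_betw_diagonals: "bij_betw (\<lambda>(m, k). (k + m, k)) (UNIV :: (int \<times> int) set) (UNIV :: (int \<times> int) set)"
  by (rule bij_betwI[where g = "\<lambda>(i, j). (i - j, j)"]) auto

lemma
  fixes f :: "int \<times> int \<Rightarrow> 'b::banach"
  assumes "f summable_on UNIV"
  shows summable_on_diagonal: "(\<lambda>k. f (k + m, k)) summable_on UNIV"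
    and summable_on_diagonal_sums: "(\<lambda>m. \<Sum>\<^sub>\<infinity>k. f (k + m, k)) summable_on UNIV"
    and infsum_by_diagonals: "(\<Sum>\<^sub>\<infinity>m. \<Sum>\<^sub>\<infinity>k. f (k + m, k)) = infsum f UNIV"
proof -
  let ?g = "\<lambda>m k. f (k + m, k)"
  have eq: "(\<lambda>x. f (case x of (m, k) \<Rightarrow> (k + m, k))) = (\<lambda>(m, k). ?g m k)"
    by (auto simp: fun_eq_iff)
  have s: "(\<lambda>(m, k). ?g m k) summable_on UNIV \<times> UNIV"
    using assms summable_on_reindex_bij_betw[OF bij_betw_diagonals, of f] by (simp add: eq)
  show "(\<lambda>k. f (k + m, k)) summable_on UNIV"
  proof -
    have "f summable_on range (\<lambda>k. (k + m, k))"
      using assms by (rule summable_on_subset_banach) auto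
    then show ?thesis
      by (subst (asm) summable_on_reindex) (auto intro: injI simp: o_def)
  qed
  show "(\<lambda>m. \<Sum>\<^sub>\<infinity>k. f (k + m, k)) summable_on UNIV"
    using summable_on_Sigma_banach[OF s] by simp
  have "(\<Sum>\<^sub>\<infinity>m. \<Sum>\<^sub>\<infinity>k. f (k + m, k)) = infsum (\<lambda>(m, k). ?g m k) (UNIV \<times> UNIV)"
    using infsum_Sigma'_banach[OF s] by simp
  also have "\<dots> = infsum f UNIV"
    using infsum_reindex_bij_betw[OF bij_betw_diagonals, of f] by (simp add: eq)
  finally show "(\<Sum>\<^sub>\<infinity>m. \<Sum>\<^sub>\<infinity>k. f (k + m, k)) = infsum f UNIV" .
qed

lemma summable_on_by_diagonals:
  fixes f :: "int \<times> int \<Rightarrow> real"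
  assumes nonneg: "\<And>x. 0 \<le> f x"
    and d: "\<And>m. (\<lambda>k. f (k + m, k)) summable_on UNIV"
    and b: "\<And>m. (\<Sum>\<^sub>\<infinity>k. f (k + m, k)) \<le> g m" and g: "g summable_on UNIV"
  shows "f summable_on UNIV" "infsum f UNIV \<le> infsum g UNIV"
proof -
  have dg: "(\<lambda>m. \<Sum>\<^sub>\<infinity>k. f (k + m, k)) summable_on UNIV"
    using g b by (rule summable_on_comparison_test) (auto intro: infsum_nonneg nonneg)
  have "(\<lambda>(m, k). f (k + m, k)) summable_on UNIV \<times> UNIV"
    using d dg nonneg by (intro summable_on_SigmaI[where g = "\<lambda>m. \<Sum>\<^sub>\<infinity>k. f (k + m, k)"]) auto
  moreover have "(\<lambda>x. f (case x of (m, k) \<Rightarrow> (k + m, k))) = (\<lambda>(m, k). f (k + m, k))"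
    by (auto simp: fun_eq_iff)
  ultimately show f: "f summable_on UNIV"
    using summable_on_reindex_bij_betw[OF bij_betw_diagonals, of f] by simp
  show "infsum f UNIV \<le> infsum g UNIV"
    unfolding infsum_by_diagonals[OF f, symmetric]
    using dg g b by (rule infsum_mono)
qed

section \<open>The weighted Hilbert space of matrices\<close>

definition wt :: "(int \<Rightarrow> real) \<Rightarrow> int \<Rightarrow> int \<Rightarrow> real" where
  "wt w i j = sqrt (sval w i) * sqrt (sval w j)"

text \<open>Entries normalised so that the norm of the Hilbert space becomes an unweighted \<open>\<ell>\<^sup>2\<close> norm;
  the finite Minkowski inequality for \<open>L2_set\<close> then applies directly.\<close>

definition wmod :: "(int \<Rightarrow> real) \<Rightarrow> mat \<Rightarrow> int \<times> int \<Rightarrow> real" where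
  "wmod w a = (\<lambda>(i, j). sqrt (wt w i j) * cmod (a i j))"

locale weighted_hs =
  fixes w :: "int \<Rightarrow> real"
  assumes sval_pos: "0 < sval w k"
    and sval_summable: "sval w summable_on UNIV"
begin

lemma wt_pos: "0 < wt w i j"
  using sval_pos by (simp add: wt_def)

lemma wmod_nonneg: "0 \<le> wmod w a x"
  using less_imp_le[OF wt_pos] by (auto simp: wmod_def split: prod.split)

lemma wmod_sq: "(wmod w a (i, j))\<^sup>2 = wt w i j * (cmod (a i j))\<^sup>2"
  using less_imp_le[OF wt_pos] by (simp add: wmod_def power_mult_distrib)

lemma HS_iff: "a \<in> HS w \<longleftrightarrow> (\<lambda>x. (wmod w a x)\<^sup>2) summable_on UNIV"
proof -
  have "(\<lambda>x. (wmod w a x)\<^sup>2) = (\<lambda>(i, j). sqrt (sval w i) * sqrt (sval w j) * (cmod (a i j))\<^sup>2)"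
    by (auto simp: fun_eq_iff wmod_sq wt_def)
  then show ?thesis by (simp add: HS_def)
qed

lemma hs_inner_self: "hs_inner w a a = of_real (\<Sum>\<^sub>\<infinity>x. (wmod w a x)\<^sup>2)"
proof -
  have "hs_inner w a a = (\<Sum>\<^sub>\<infinity>x. of_real ((wmod w a x)\<^sup>2))"
    unfolding hs_inner_def
    by (intro infsum_cong)
       (auto simp: wmod_sq wt_def mult_ac complex_norm_square simp del: of_real_power)
  also have "\<dots> = of_real (\<Sum>\<^sub>\<infinity>x. (wmod w a x)\<^sup>2)"
  proof (cases "(\<lambda>x. (wmod w a x)\<^sup>2) summable_on UNIV")
    case True
    then show ?thesis
      by (intro infsumI has_sum_of_real) simp
  next
    case False
    then have "\<not> (\<lambda>x. complex_of_real ((wmod w a x)\<^sup>2)) summable_on UNIV"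
      using summable_on_Re by fastforce
    with False show ?thesis
      by (simp add: infsum_not_exists del: of_real_power)
  qed
  finally show ?thesis .
qed

lemma hs_norm_eq: "hs_norm w a = sqrt (\<Sum>\<^sub>\<infinity>x. (wmod w a x)\<^sup>2)"
  by (simp add: hs_norm_def hs_inner_self)

lemma hs_norm_nonneg: "0 \<le> hs_norm w a"
  by (simp add: hs_norm_eq infsum_nonneg)

lemma hs_norm_sq: "(hs_norm w a)\<^sup>2 = (\<Sum>\<^sub>\<infinity>x. (wmod w a x)\<^sup>2)"
  by (simp add: hs_norm_eq infsum_nonneg)

lemma hs_norm_sq_eq_inner: "hs_inner w a a = of_real ((hs_norm w a)\<^sup>2)"
  by (simp only: hs_inner_self hs_norm_sq)

text \<open>Membership and norm bounds are read off from finite sums, which avoids manipulating infinite sums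
  in the triangle inequality and in the compactness argument.\<close>

lemma HS_leI:
  assumes "\<And>F. finite F \<Longrightarrow> L2_set (wmod w a) F \<le> c"
  shows "a \<in> HS w" "hs_norm w a \<le> c"
proof -
  have c: "0 \<le> c" using assms[of "{}"] by simp
  have *: "(\<Sum>x\<in>F. (wmod w a x)\<^sup>2) \<le> c\<^sup>2" if "finite F" for F
  proof -
    have "(L2_set (wmod w a) F)\<^sup>2 \<le> c\<^sup>2"
      using assms[OF that] by (intro power_mono) auto
    then show ?thesis
      unfolding L2_set_def by (simp add: sum_nonneg)
  qed
  show "a \<in> HS w"
    unfolding HS_iff by (rule finite_sums_le_imp_summable_on(1)) (auto intro: *)
  have "(\<Sum>\<^sub>\<infinity>x. (wmod w a x)\<^sup>2) \<le> c\<^sup>2"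
    by (rule finite_sums_le_imp_summable_on(2)) (auto intro: *)
  then show "hs_norm w a \<le> c"
    using c by (simp add: hs_norm_eq real_le_lsqrt infsum_nonneg)
qed

lemma L2_set_le_hs_norm:
  assumes "a \<in> HS w" "finite F"
  shows "L2_set (wmod w a) F \<le> hs_norm w a"
  unfolding L2_set_def hs_norm_eq
  using assms by (intro real_sqrt_le_mono finite_sum_le_infsum) (auto simp: HS_iff)

lemma wmod_le_hs_norm: "a \<in> HS w \<Longrightarrow> wmod w a x \<le> hs_norm w a"
  using L2_set_le_hs_norm[of a "{x}"] wmod_nonneg[of a x] by (simp add: L2_set_def)

lemma
  assumes "a \<in> HS w" "b \<in> HS w"
  shows HS_add: "a + b \<in> HS w" and hs_norm_triangle: "hs_norm w (a + b) \<le> hs_norm w a + hs_norm w b"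
proof -
  have "wmod w (a + b) x \<le> wmod w a x + wmod w b x" for x
    using less_imp_le[OF wt_pos]
    by (auto simp: wmod_def norm_triangle_ineq mult_left_mono simp flip: distrib_left split: prod.split)
  then have "L2_set (wmod w (a + b)) F \<le> L2_set (\<lambda>x. wmod w a x + wmod w b x) F" for F
    by (intro L2_set_mono wmod_nonneg) auto
  also have "\<dots> F \<le> L2_set (wmod w a) F + L2_set (wmod w b) F" for F
    by (rule L2_set_triangle_ineq)
  also have "\<dots> F \<le> hs_norm w a + hs_norm w b" if "finite F" for F
    using assms that by (intro add_mono L2_set_le_hs_norm) auto
  finally have *: "L2_set (wmod w (a + b)) F \<le> hs_norm w a + hs_norm w b" if "finite F" for F
    using that by blast
  show "a + b \<in> HS w" "hs_norm w (a + b) \<le> hs_norm w a + hs_norm w b"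
    by (rule HS_leI[OF *], assumption)+
qed

lemma wmod_mono_imp:
  assumes "b \<in> HS w" "\<And>x. wmod w a x \<le> wmod w b x"
  shows "a \<in> HS w" "hs_norm w a \<le> hs_norm w b"
proof -
  have *: "L2_set (wmod w a) F \<le> hs_norm w b" if "finite F" for F
    using L2_set_mono[of F "wmod w a" "wmod w b"] L2_set_le_hs_norm[OF assms(1) that] assms(2)
      wmod_nonneg
    by fastforce
  show "a \<in> HS w" "hs_norm w a \<le> hs_norm w b"
    by (rule HS_leI[OF *], assumption)+
qed

lemma wmod_mscale: "wmod w (mscale c a) x = cmod c * wmod w a x"
  by (auto simp: wmod_def mscale_def norm_mult split: prod.split)

lemma HS_mscale: "a \<in> HS w \<Longrightarrow> mscale c a \<in> HS w"
  by (auto simp: HS_iff wmod_mscale power_mult_distrib intro: summable_on_cmult_right)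

lemma HS_zero: "0 \<in> HS w"
  by (simp add: HS_iff wmod_def case_prod_unfold)

lemma subspace_HS: "mat.subspace (HS w)"
  by (simp add: mat.subspace_def HS_zero HS_add HS_mscale)

lemma HS_diff: "a \<in> HS w \<Longrightarrow> b \<in> HS w \<Longrightarrow> a - b \<in> HS w"
  by (rule mat.subspace_diff[OF subspace_HS])

lemma hs_norm_minus_commute: "hs_norm w (a - b) = hs_norm w (b - a)"
proof -
  have "wmod w (a - b) = wmod w (b - a)"
    by (auto simp: wmod_def norm_minus_commute fun_eq_iff)
  then show ?thesis by (simp add: hs_norm_eq)
qed

lemma hs_norm_zero_iff: "a \<in> HS w \<Longrightarrow> hs_norm w a = 0 \<longleftrightarrow> a = 0"
proof
  assume a: "a \<in> HS w" "hs_norm w a = 0"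
  have "wmod w a (i, j) = 0" for i j
    using wmod_le_hs_norm[OF a(1)] wmod_nonneg[of a] a(2) by (simp add: order_antisym)
  then show "a = 0"
    using wt_pos[THEN less_imp_neq, symmetric] by (auto simp: wmod_def fun_eq_iff)
qed (simp add: hs_norm_eq wmod_def case_prod_unfold)

lemma Metric_space_HS: "Metric_space (HS w) (\<lambda>a b. hs_norm w (a - b))"
proof
  fix x y z assume xyz: "x \<in> HS w" "y \<in> HS w" "z \<in> HS w"
  show "hs_norm w (x - y) = 0 \<longleftrightarrow> x = y"
    using hs_norm_zero_iff[OF HS_diff[OF xyz(1,2)]] by simp
  show "hs_norm w (x - z) \<le> hs_norm w (x - y) + hs_norm w (y - z)"
    using hs_norm_triangle[OF HS_diff[OF xyz(1,2)] HS_diff[OF xyz(2,3)]] by simp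
qed (simp_all add: hs_norm_nonneg hs_norm_minus_commute)

lemma topspace_hs_top: "topspace (hs_top w) = HS w"
  unfolding hs_top_def by (rule Metric_space.topspace_mtopology[OF Metric_space_HS])

lemma hs_inner_eq: "hs_inner w a b = (\<Sum>\<^sub>\<infinity>x. case x of (i, j) \<Rightarrow> of_real (wt w i j) * (cnj (a i j) * b i j))"
  unfolding hs_inner_def by (intro infsum_cong) (auto simp: wt_def mult_ac)

lemma inner_summable:
  assumes "a \<in> HS w" "b \<in> HS w"
  shows "(\<lambda>(i, j). complex_of_real (wt w i j) * (cnj (a i j) * b i j)) summable_on UNIV"
proof (rule abs_summable_summable, rule summable_on_comparison_test)
  show "(\<lambda>x. (wmod w a x)\<^sup>2 + (wmod w b x)\<^sup>2) summable_on UNIV"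
    using assms by (intro summable_on_add) (auto simp: HS_iff)
  fix x :: "int \<times> int"
  obtain i j where x: "x = (i, j)" by fastforce
  have "norm (complex_of_real (wt w i j) * (cnj (a i j) * b i j)) = wmod w a x * wmod w b x"
    using wt_pos[of i j] by (simp add: x wmod_def norm_mult mult_ac flip: real_sqrt_mult)
  moreover have "wmod w a x * wmod w b x \<le> (wmod w a x)\<^sup>2 + (wmod w b x)\<^sup>2"
    using sum_squares_bound[of "wmod w a x" "wmod w b x"]
    mult_nonneg_nonneg[OF wmod_nonneg[of a x] wmod_nonneg[of b x]] by linarith
  ultimately show "norm (case x of (i, j) \<Rightarrow> complex_of_real (wt w i j) * (cnj (a i j) * b i j)) \<le> (wmod w a x)\<^sup>2 + (wmod w b x)\<^sup>2"
    by (simp add: x)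
qed auto

lemma hs_inner_add_right:
  assumes "a \<in> HS w" "b \<in> HS w" "c \<in> HS w"
  shows "hs_inner w a (b + c) = hs_inner w a b + hs_inner w a c"
  unfolding hs_inner_eq
  using infsum_add[OF inner_summable[OF assms(1,2)] inner_summable[OF assms(1,3)]]
  by (simp add: case_prod_unfold algebra_simps)

lemma hs_inner_mscale_right: "hs_inner w a (mscale c b) = c * hs_inner w a b"
  unfolding hs_inner_eq
  by (simp add: case_prod_unfold mscale_def mult_ac flip: infsum_cmult_right')

lemma hs_inner_commute: "hs_inner w b a = cnj (hs_inner w a b)"
  unfolding hs_inner_eq infsum_cnj[symmetric]
  by (simp add: case_prod_unfold mult_ac)

lemma hs_inner_diff_right:
  assumes "a \<in> HS w" "b \<in> HS w" "c \<in> HS w"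
  shows "hs_inner w a (b - c) = hs_inner w a b - hs_inner w a c"
  using hs_inner_add_right[OF assms(1) HS_diff[OF assms(2,3)] assms(3)] by simp

lemma hs_inner_zero_right: "hs_inner w a 0 = 0"
  by (simp add: hs_inner_eq case_prod_unfold)

lemma hs_inner_sum_right:
  assumes "a \<in> HS w" "\<And>n. n \<in> A \<Longrightarrow> e n \<in> HS w"
  shows "hs_inner w a (\<Sum>n\<in>A. e n) = (\<Sum>n\<in>A. hs_inner w a (e n))"
  using assms(2)
proof (induction A rule: infinite_finite_induct)
  case (insert x F)
  then have "(\<Sum>n\<in>F. e n) \<in> HS w"
    by (intro mat.subspace_sum[OF subspace_HS]) auto
  moreover have "e x \<in> HS w"
    using insert by simp
  ultimately show ?case
    using insert unfolding sum.insert[OF insert.hyps]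
    by (subst hs_inner_add_right[OF assms(1)]) auto
qed (simp_all add: hs_inner_zero_right)

end

section \<open>Operators dominated along diagonals\<close>

context weighted_hs begin

definition diag_l1 :: "mat \<Rightarrow> int \<Rightarrow> real" where
  "diag_l1 y m = (\<Sum>\<^sub>\<infinity>k. wt w (k + m) k * cmod (y (k + m) k))"

definition diag_sq :: "mat \<Rightarrow> int \<Rightarrow> real" where
  "diag_sq y m = (\<Sum>\<^sub>\<infinity>k. (wmod w y (k + m, k))\<^sup>2)"

abbreviation "trS \<equiv> infsum (sval w) UNIV"

lemma trS_pos: "0 < trS"
proof -
  have "sval w 0 \<le> trS"
    using finite_sum_le_infsum[OF sval_summable, of "{0}"] less_imp_le[OF sval_pos] by simp
  then show ?thesis using sval_pos[of 0] by linarith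
qed

lemma sval_shift:
  shows "(\<lambda>k. sval w (k + m)) summable_on S" "(\<Sum>\<^sub>\<infinity>k\<in>S. sval w (k + m)) \<le> trS"
    "(\<Sum>\<^sub>\<infinity>k\<in>S. sval w (k + m)) = (\<Sum>\<^sub>\<infinity>k\<in>(\<lambda>k. k + m) ` S. sval w k)"
proof -
  have inj: "inj_on (\<lambda>k. k + m) S" by (auto intro: inj_onI)
  have sub: "sval w summable_on A" for A
    using sval_summable by (rule summable_on_subset) auto
  show "(\<lambda>k. sval w (k + m)) summable_on S"
    using sub summable_on_reindex[OF inj, of "sval w"] by (simp add: o_def)
  show eq: "(\<Sum>\<^sub>\<infinity>k\<in>S. sval w (k + m)) = (\<Sum>\<^sub>\<infinity>k\<in>(\<lambda>k. k + m) ` S. sval w k)"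
    using infsum_reindex[OF inj, of "sval w"] by (simp add: o_def)
  show "(\<Sum>\<^sub>\<infinity>k\<in>S. sval w (k + m)) \<le> trS"
    unfolding eq using less_imp_le[OF sval_pos] by (intro infsum_mono2 sub) auto
qed

text \<open>Cauchy-Schwarz for \<open>wt w (k + m) k = sqrt (s (k + m)) * sqrt (s k)\<close>. It makes the total weight
  of a diagonal at most the trace of \<open>S\<close>, whichever diagonal it is.\<close>

lemma
  shows wt_diagonal_summable: "(\<lambda>k. wt w (k + m) k) summable_on S"
    and wt_diagonal_cauchy_schwarz:
      "(\<Sum>\<^sub>\<infinity>k\<in>S. wt w (k + m) k)\<^sup>2 \<le> (\<Sum>\<^sub>\<infinity>k\<in>S. sval w k) * (\<Sum>\<^sub>\<infinity>k\<in>S. sval w (k + m))"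
proof -
  \<comment> \<open>with weights \<open>s k\<close>, the sequence \<open>?x\<close> has \<open>s k * ?x k = wt w (k + m) k\<close> and \<open>s k * (?x k)\<^sup>2 = s (k + m)\<close>\<close>
  let ?x = "\<lambda>k. sqrt (sval w (k + m)) / sqrt (sval w k)"
  have eq1: "sval w k * ?x k = wt w (k + m) k" for k
  proof -
    have "sval w k = sqrt (sval w k) * sqrt (sval w k)"
      using less_imp_le[OF sval_pos[of k]] by simp
    then show ?thesis
      using sval_pos[of k] by (simp add: wt_def field_simps)
  qed
  have eq2: "sval w k * (?x k)\<^sup>2 = sval w (k + m)" for k
    using sval_pos[of k] less_imp_le[OF sval_pos[of "k + m"]] by (simp add: power_divide)
  note cs = summable_on_weighted_cauchy_schwarz[of S "sval w" ?x, unfolded eq1 eq2]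
  have "sval w summable_on S"
    using sval_shift(1)[of 0 S] by simp
  then show "(\<lambda>k. wt w (k + m) k) summable_on S"
    "(\<Sum>\<^sub>\<infinity>k\<in>S. wt w (k + m) k)\<^sup>2 \<le> (\<Sum>\<^sub>\<infinity>k\<in>S. sval w k) * (\<Sum>\<^sub>\<infinity>k\<in>S. sval w (k + m))"
    using less_imp_le[OF sval_pos] sval_shift(1) by (auto intro!: cs)
qed

lemma sval_infsum_nonneg: "0 \<le> (\<Sum>\<^sub>\<infinity>k\<in>S. sval w (k + m))"
  using less_imp_le[OF sval_pos] by (simp add: infsum_nonneg)

lemma wt_diagonal_le_trS: "(\<Sum>\<^sub>\<infinity>k\<in>S. wt w (k + m) k) \<le> trS"
proof -
  have "(\<Sum>\<^sub>\<infinity>k\<in>S. wt w (k + m) k)\<^sup>2 \<le> trS * trS"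
    using wt_diagonal_cauchy_schwarz[of m S]
      mult_mono[OF sval_shift(2)[of 0 S] sval_shift(2)[of m S]] trS_pos sval_infsum_nonneg[of m S] by simp
  then show ?thesis
    using trS_pos by (metis power2_eq_square power2_le_imp_le less_imp_le)
qed

text \<open>The source of compactness: one square \<open>F \<times> F\<close> captures all but a small part of the weight of
  every diagonal simultaneously. Outside the square one of the two indices leaves \<open>F\<close>, and the
  Cauchy-Schwarz estimate bounds each of the two resulting sums without reference to \<open>m\<close>.\<close>

lemma wt_diagonal_tail:
  assumes F: "(\<Sum>\<^sub>\<infinity>k\<in>- F. sval w k) \<le> d"
  shows "(\<Sum>\<^sub>\<infinity>k\<in>{k. (k + m, k) \<notin> F \<times> F}. wt w (k + m) k) \<le> 2 * sqrt (d * trS)"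
proof -
  let ?A = "- F" and ?B = "(\<lambda>k. k - m) ` (- F)"
  have sub: "{k. (k + m, k) \<notin> F \<times> F} = ?A \<union> ?B"
    by (auto simp: image_iff) (metis ComplI add_diff_cancel_right')
  have img: "(\<lambda>k. k + m) ` ?B = - F"
    by (auto simp: image_image)
  have A: "(\<Sum>\<^sub>\<infinity>k\<in>?A. wt w (k + m) k) \<le> sqrt (d * trS)"
  proof (rule real_le_rsqrt)
    show "(\<Sum>\<^sub>\<infinity>k\<in>?A. wt w (k + m) k)\<^sup>2 \<le> d * trS"
      using wt_diagonal_cauchy_schwarz[of m ?A]
        mult_mono[OF F sval_shift(2)[of m ?A]] sval_infsum_nonneg[of 0 ?A] sval_infsum_nonneg[of m ?A] F by simp
  qed
  have B: "(\<Sum>\<^sub>\<infinity>k\<in>?B. wt w (k + m) k) \<le> sqrt (d * trS)"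
  proof (rule real_le_rsqrt)
    have "(\<Sum>\<^sub>\<infinity>k\<in>?B. sval w k) * (\<Sum>\<^sub>\<infinity>k\<in>?B. sval w (k + m)) \<le> trS * d"
      using F sval_shift(2)[of 0 ?B] trS_pos sval_infsum_nonneg[of m ?B] 
      by (intro mult_mono) (auto simp: sval_shift(3)[of m ?B] img)
    then show "(\<Sum>\<^sub>\<infinity>k\<in>?B. wt w (k + m) k)\<^sup>2 \<le> d * trS"
      using wt_diagonal_cauchy_schwarz[of m ?B] by (simp add: mult.commute)
  qed
  have "(\<Sum>\<^sub>\<infinity>k\<in>?A \<union> ?B. wt w (k + m) k)
      = (\<Sum>\<^sub>\<infinity>k\<in>?A. wt w (k + m) k) + (\<Sum>\<^sub>\<infinity>k\<in>?B - ?A. wt w (k + m) k)"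
    by (subst infsum_Un_disjoint[symmetric]) (auto intro!: wt_diagonal_summable arg_cong[where f = "infsum _"])
  also have "(\<Sum>\<^sub>\<infinity>k\<in>?B - ?A. wt w (k + m) k) \<le> (\<Sum>\<^sub>\<infinity>k\<in>?B. wt w (k + m) k)"
    using less_imp_le[OF wt_pos] by (intro infsum_mono2 wt_diagonal_summable) auto
  finally show ?thesis
    using A B unfolding sub by linarith
qed

lemma
  assumes "y \<in> HS w"
  shows diag_sq_summable1: "(\<lambda>k. (wmod w y (k + m, k))\<^sup>2) summable_on UNIV"
    and diag_sq_summable: "diag_sq y summable_on UNIV"
    and diag_sq_sum: "infsum (diag_sq y) UNIV = (hs_norm w y)\<^sup>2"
  using summable_on_diagonal summable_on_diagonal_sums infsum_by_diagonals assms
  unfolding HS_iff diag_sq_def[abs_def] hs_norm_sq by fast+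

lemma diag_sq_nonneg: "0 \<le> diag_sq y m"
  by (simp add: diag_sq_def infsum_nonneg)

lemma diag_l1_nonneg: "0 \<le> diag_l1 y m"
  using less_imp_le[OF wt_pos] by (simp add: diag_l1_def infsum_nonneg)

lemma
  assumes y: "y \<in> HS w" and S: "\<And>k. k \<notin> S \<Longrightarrow> y (k + m) k = 0"
  shows diag_l1_summable_on: "(\<lambda>k. wt w (k + m) k * cmod (y (k + m) k)) summable_on UNIV"
    and diag_l1_sq_le_on: "(diag_l1 y m)\<^sup>2 \<le> (\<Sum>\<^sub>\<infinity>k\<in>S. wt w (k + m) k) * diag_sq y m"
proof -
  let ?f = "\<lambda>k. wt w (k + m) k * cmod (y (k + m) k)"
  let ?g = "\<lambda>k. wt w (k + m) k * (cmod (y (k + m) k))\<^sup>2"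
  have eq: "?g k = (wmod w y (k + m, k))\<^sup>2" for k
    by (simp add: wmod_sq)
  have "?g summable_on UNIV"
    unfolding eq by (rule diag_sq_summable1[OF y])
  then have g: "?g summable_on S"
    by (rule summable_on_subset) auto
  note cs = summable_on_weighted_cauchy_schwarz[of S "\<lambda>k. wt w (k + m) k" "\<lambda>k. cmod (y (k + m) k)",
      OF _ _ wt_diagonal_summable g]
  have "?f summable_on S"
    using less_imp_le[OF wt_pos] by (intro cs) auto
  then show "?f summable_on UNIV"
    by (subst summable_on_cong_neutral[where T = S and g = ?f]) (auto simp: S)
  have "diag_l1 y m = infsum ?f S"
    unfolding diag_l1_def by (rule infsum_cong_neutral) (auto simp: S)
  moreover have "diag_sq y m = infsum ?g S"
    unfolding diag_sq_def eq[symmetric] by (rule infsum_cong_neutral) (auto simp: S)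
  moreover have "(infsum ?f S)\<^sup>2 \<le> (\<Sum>\<^sub>\<infinity>k\<in>S. wt w (k + m) k) * infsum ?g S"
    using less_imp_le[OF wt_pos] by (intro cs) auto
  ultimately show "(diag_l1 y m)\<^sup>2 \<le> (\<Sum>\<^sub>\<infinity>k\<in>S. wt w (k + m) k) * diag_sq y m"
    by simp
qed

lemma diag_l1_summable:
  "y \<in> HS w \<Longrightarrow> (\<lambda>k. wt w (k + m) k * cmod (y (k + m) k)) summable_on UNIV"
  by (rule diag_l1_summable_on[where S = UNIV]) auto

lemma diag_l1_sq_le: "y \<in> HS w \<Longrightarrow> (diag_l1 y m)\<^sup>2 \<le> trS * diag_sq y m"
  using diag_l1_sq_le_on[of y UNIV m] wt_diagonal_le_trS[of m UNIV] diag_sq_nonneg[of y m]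
  by (meson UNIV_I mult_right_mono order_trans)

lemma diag_l1_le_hs_norm:
  assumes "y \<in> HS w" shows "diag_l1 y m \<le> sqrt trS * hs_norm w y"
proof (rule power2_le_imp_le)
  have "diag_sq y m \<le> (hs_norm w y)\<^sup>2"
    using finite_sum_le_infsum[OF diag_sq_summable[OF assms], of "{m}"] diag_sq_nonneg
    by (simp add: diag_sq_sum[OF assms])
  then have "trS * diag_sq y m \<le> trS * (hs_norm w y)\<^sup>2"
    using trS_pos by simp
  with diag_l1_sq_le[OF assms, of m] have "(diag_l1 y m)\<^sup>2 \<le> trS * (hs_norm w y)\<^sup>2"
    by (rule order_trans)
  then show "(diag_l1 y m)\<^sup>2 \<le> (sqrt trS * hs_norm w y)\<^sup>2"
    using trS_pos by (simp add: power_mult_distrib)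
qed (use trS_pos in \<open>simp add: hs_norm_nonneg\<close>)

text \<open>The constant must not depend on the diagonal \<open>m\<close>. The operator moves diagonals down by \<open>p\<close>, which
  is \<open>1\<close> for right inverses of \<open>D\<close> and \<open>0\<close> for the projections onto kernel and cokernel.\<close>

definition dominated :: "int \<Rightarrow> (mat \<Rightarrow> mat) \<Rightarrow> bool" where
  "dominated p Q \<longleftrightarrow>
     (\<forall>y\<in>HS w. \<forall>z\<in>HS w. Q (y + z) = Q y + Q z) \<and> (\<forall>c. \<forall>y\<in>HS w. Q (mscale c y) = mscale c (Q y)) \<and>
     (\<exists>B\<ge>0. \<forall>y\<in>HS w. \<forall>m k. cmod (Q y (k + m) k) \<le> B * diag_l1 y (m + p))"

text \<open>The factor \<open>t\<close> compares the squared \<open>\<ell>\<^sup>1\<close> norm of a diagonal of \<open>y\<close> with its squared \<open>\<ell>\<^sup>2\<close>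
  norm. In general \<open>t\<close> is the trace of \<open>S\<close>, which gives boundedness; for \<open>y\<close> vanishing on a large
  square it is small, which gives compactness.\<close>

lemma HS_bound_of_diag_l1_bound:
  assumes y: "y \<in> HS w" and B: "0 \<le> B" and t: "0 \<le> t"
    and bound: "\<And>m k. cmod (x (k + m) k) \<le> B * diag_l1 y (m + p)"
    and l1: "\<And>m. (diag_l1 y m)\<^sup>2 \<le> t * diag_sq y m"
  shows "x \<in> HS w" "hs_norm w x \<le> B * sqrt (trS * t) * hs_norm w y"
proof -
  let ?f = "\<lambda>z. (wmod w x z)\<^sup>2"
  let ?g = "\<lambda>m. (B\<^sup>2 * trS * t) * diag_sq y (m + p)"
  have bij: "bij_betw (\<lambda>m. m + p) UNIV UNIV"
    by (rule bij_betwI[where g = "\<lambda>m. m - p"]) auto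
  have gs: "?g summable_on UNIV" and gi: "infsum ?g UNIV = (B\<^sup>2 * trS * t) * (hs_norm w y)\<^sup>2"
    using diag_sq_summable[OF y] diag_sq_sum[OF y]
      summable_on_reindex_bij_betw[OF bij, of "diag_sq y"] infsum_reindex_bij_betw[OF bij, of "diag_sq y"]
    by (simp_all add: summable_on_cmult_right infsum_cmult_right')
  have le: "?f (k + m, k) \<le> wt w (k + m) k * (B * diag_l1 y (m + p))\<^sup>2" for m k
    unfolding wmod_sq using less_imp_le[OF wt_pos] bound
    by (intro mult_left_mono power_mono) auto
  have s: "(\<lambda>k. wt w (k + m) k * (B * diag_l1 y (m + p))\<^sup>2) summable_on UNIV" for m
    by (intro summable_on_cmult_left wt_diagonal_summable)
  have d: "(\<lambda>k. ?f (k + m, k)) summable_on UNIV" for m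
    using s[of m] le by (rule summable_on_comparison_test) auto
  have b: "(\<Sum>\<^sub>\<infinity>k. ?f (k + m, k)) \<le> ?g m" for m
  proof -
    have "(\<Sum>\<^sub>\<infinity>k. ?f (k + m, k)) \<le> (\<Sum>\<^sub>\<infinity>k. wt w (k + m) k * (B * diag_l1 y (m + p))\<^sup>2)"
      using d s le by (rule infsum_mono)
    also have "\<dots> = (\<Sum>\<^sub>\<infinity>k. wt w (k + m) k) * (B\<^sup>2 * (diag_l1 y (m + p))\<^sup>2)"
      by (simp add: infsum_cmult_left' power_mult_distrib)
    also have "\<dots> \<le> trS * (B\<^sup>2 * (t * diag_sq y (m + p)))"
      using l1 trS_pos by (intro mult_mono wt_diagonal_le_trS) auto
    finally show ?thesis by (simp add: mult_ac)
  qed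
  note r = summable_on_by_diagonals[of ?f, OF _ d b gs]
  show "x \<in> HS w"
    unfolding HS_iff by (rule r) auto
  have "(hs_norm w x)\<^sup>2 \<le> (B\<^sup>2 * trS * t) * (hs_norm w y)\<^sup>2"
    unfolding hs_norm_sq[of x] gi[symmetric] by (rule r) auto
  also have "\<dots> = (B * sqrt (trS * t) * hs_norm w y)\<^sup>2"
    using trS_pos t by (simp add: power_mult_distrib)
  finally show "hs_norm w x \<le> B * sqrt (trS * t) * hs_norm w y"
    using B t trS_pos by (auto intro!: power2_le_imp_le mult_nonneg_nonneg simp: hs_norm_nonneg)
qed

lemma dominated_HS: "dominated p Q \<Longrightarrow> y \<in> HS w \<Longrightarrow> Q y \<in> HS w"
  unfolding dominated_def
  using HS_bound_of_diag_l1_bound(1)[of y _ trS "Q y" p] diag_l1_sq_le[of y] less_imp_le[OF trS_pos]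
  by blast

lemma dominated_linear: "dominated p Q \<Longrightarrow> linear_between (HS w) (HS w) Q"
  using dominated_HS subspace_HS by (auto simp: linear_between_def dominated_def)

lemma dominated_bounded: "dominated p Q \<Longrightarrow> bounded_op w Q"
  unfolding bounded_op_def
proof
  assume Q: "dominated p Q"
  then obtain B where B: "B \<ge> 0" "\<And>y m k. y \<in> HS w \<Longrightarrow> cmod (Q y (k + m) k) \<le> B * diag_l1 y (m + p)"
    by (auto simp: dominated_def)
  have "hs_norm w (Q a) \<le> B * sqrt (trS * trS) * hs_norm w a" if "a \<in> HS w" for a
    using that B trS_pos diag_l1_sq_le by (intro HS_bound_of_diag_l1_bound(2)[where p = p]) auto
  then show "\<exists>C. \<forall>a\<in>HS w. hs_norm w (Q a) \<le> C * hs_norm w a" by blast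
qed (rule dominated_linear)

lemma dominated_diff:
  assumes "dominated p Q" "y \<in> HS w" "z \<in> HS w"
  shows "Q (y - z) = Q y - Q z"
proof -
  have "Q ((y - z) + z) = Q (y - z) + Q z"
    using assms HS_diff unfolding dominated_def by blast
  then show ?thesis by (simp add: algebra_simps)
qed

lemma dominated_minus:
  assumes P: "dominated p P" and Q: "dominated p Q"
  shows "dominated p (\<lambda>y. P y - Q y)"
  unfolding dominated_def
proof (intro conjI ballI allI)
  obtain B where B: "B \<ge> 0" "\<And>y m k. y \<in> HS w \<Longrightarrow> cmod (P y (k + m) k) \<le> B * diag_l1 y (m + p)"
    using P by (auto simp: dominated_def)
  obtain C where C: "C \<ge> 0" "\<And>y m k. y \<in> HS w \<Longrightarrow> cmod (Q y (k + m) k) \<le> C * diag_l1 y (m + p)"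
    using Q by (auto simp: dominated_def)
  have "cmod ((P y - Q y) (k + m) k) \<le> (B + C) * diag_l1 y (m + p)" if "y \<in> HS w" for y m k
    using norm_triangle_ineq4[of "P y (k + m) k" "Q y (k + m) k"] B(2)[OF that, of k m] C(2)[OF that, of k m]
    by (simp add: algebra_simps)
  then show "\<exists>D\<ge>0. \<forall>y\<in>HS w. \<forall>m k. cmod ((P y - Q y) (k + m) k) \<le> D * diag_l1 y (m + p)"
    using B(1) C(1) by (intro exI[of _ "B + C"]) auto
next
  fix c y assume "y \<in> HS w"
  with P Q have "P (mscale c y) = mscale c (P y)" "Q (mscale c y) = mscale c (Q y)"
    by (simp_all add: dominated_def)
  then show "P (mscale c y) - Q (mscale c y) = mscale c (P y - Q y)"
    by (simp add: mat.scale_right_diff_distrib)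
next
  fix y z assume "y \<in> HS w" "z \<in> HS w"
  with P Q have "P (y + z) = P y + P z" "Q (y + z) = Q y + Q z"
    by (simp_all add: dominated_def)
  then show "P (y + z) - Q (y + z) = P y - Q y + (P z - Q z)"
    by simp
qed

lemma dominated_compose:
  assumes P: "dominated p P" and Q: "dominated q Q"
  shows "dominated (p + q) (\<lambda>y. P (Q y))"
  unfolding dominated_def
proof (intro conjI ballI allI)
  obtain B where B: "B \<ge> 0" "\<And>y m k. y \<in> HS w \<Longrightarrow> cmod (P y (k + m) k) \<le> B * diag_l1 y (m + p)"
    using P by (auto simp: dominated_def)
  obtain C where C: "C \<ge> 0" "\<And>y m k. y \<in> HS w \<Longrightarrow> cmod (Q y (k + m) k) \<le> C * diag_l1 y (m + q)"
    using Q by (auto simp: dominated_def)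
  have "diag_l1 (Q y) m \<le> trS * (C * diag_l1 y (m + q))" if y: "y \<in> HS w" for y m
  proof -
    have "diag_l1 (Q y) m \<le> (\<Sum>\<^sub>\<infinity>k. wt w (k + m) k * (C * diag_l1 y (m + q)))"
      unfolding diag_l1_def[of "Q y"]
      using C(2)[OF y] less_imp_le[OF wt_pos]
      by (intro infsum_mono diag_l1_summable dominated_HS[OF Q y] summable_on_cmult_left
          wt_diagonal_summable mult_left_mono) auto
    also have "\<dots> \<le> trS * (C * diag_l1 y (m + q))"
      unfolding infsum_cmult_left' using C(1)
      by (intro mult_right_mono wt_diagonal_le_trS mult_nonneg_nonneg diag_l1_nonneg)
    finally show ?thesis .
  qed
  then have l: "B * diag_l1 (Q y) (m + p) \<le> B * (trS * (C * diag_l1 y (m + p + q)))" if "y \<in> HS w" for y m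
    using that B(1) by (intro mult_left_mono)
  then have "cmod (P (Q y) (k + m) k) \<le> B * trS * C * diag_l1 y (m + (p + q))" if "y \<in> HS w" for y m k
    using order_trans[OF B(2)[OF dominated_HS[OF Q that], of k m] l[OF that, of m]]
    by (simp add: mult.assoc add.assoc)
  then show "\<exists>D\<ge>0. \<forall>y\<in>HS w. \<forall>m k. cmod (P (Q y) (k + m) k) \<le> D * diag_l1 y (m + (p + q))"
    using B(1) C(1) trS_pos by (intro exI[of _ "B * trS * C"]) auto
next
  fix c y assume y: "y \<in> HS w"
  with Q have "Q (mscale c y) = mscale c (Q y)"
    by (simp add: dominated_def)
  with P dominated_HS[OF Q y] show "P (Q (mscale c y)) = mscale c (P (Q y))"
    by (simp add: dominated_def)
next
  fix y z assume y: "y \<in> HS w" "z \<in> HS w"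
  with Q have "Q (y + z) = Q y + Q z"
    by (simp add: dominated_def)
  with P dominated_HS[OF Q] y show "P (Q (y + z)) = P (Q y) + P (Q z)"
    by (simp add: dominated_def)
qed

section \<open>Compactness of dominated operators\<close>

definition restr :: "int set \<Rightarrow> mat \<Rightarrow> mat" where
  "restr F y = (\<lambda>i j. if (i, j) \<in> F \<times> F then y i j else 0)"

lemma wmod_restr: "wmod w (restr F y) x = (if x \<in> F \<times> F then wmod w y x else 0)"
  by (cases x) (auto simp: wmod_def restr_def)

lemma wmod_restr_compl: "wmod w (y - restr F y) x = (if x \<in> F \<times> F then 0 else wmod w y x)"
  by (cases x) (auto simp: wmod_def restr_def)

lemma hs_norm_restr:
  assumes "finite F"
  shows "restr F y \<in> HS w" "hs_norm w (restr F y) = L2_set (wmod w y) (F \<times> F)"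
proof -
  have eq: "(\<lambda>x. (wmod w (restr F y) x)\<^sup>2) = (\<lambda>x. if x \<in> F \<times> F then (wmod w y x)\<^sup>2 else 0)"
    by (auto simp: wmod_restr)
  have h: "((\<lambda>x. if x \<in> F \<times> F then (wmod w y x)\<^sup>2 else 0) has_sum (\<Sum>x\<in>F\<times>F. (wmod w y x)\<^sup>2)) UNIV"
    using assms by (intro has_sum_finite_neutralI[where B = "F \<times> F"]) auto
  show "restr F y \<in> HS w"
    unfolding HS_iff eq using h by (rule has_sum_imp_summable)
  show "hs_norm w (restr F y) = L2_set (wmod w y) (F \<times> F)"
    unfolding hs_norm_eq eq L2_set_def using infsumI[OF h] by simp
qed

text \<open>In the topology of entrywise convergence the unit ball is a closed subset of a product of discs.
  It is closed because the norm bound is a conjunction of conditions on finitely many entries each.\<close>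

lemma compact_unit_ball_pointwise: "compact {a \<in> HS w. hs_norm w a \<le> 1}"
proof -
  let ?Z = "{a \<in> HS w. hs_norm w a \<le> 1}"
  let ?K = "PiE UNIV (\<lambda>i. PiE UNIV (\<lambda>j. cball 0 (1 / sqrt (wt w i j)))) :: mat set"
  have "compact (PiE UNIV (\<lambda>j. cball 0 (1 / sqrt (wt w i j))) :: (int \<Rightarrow> complex) set)" for i
    using compactin_PiE[of "\<lambda>_. euclidean" UNIV "\<lambda>j. cball (0::complex) (1 / sqrt (wt w i j))"]
    by (simp add: euclidean_product_topology compact_cball)
  then have K: "compact ?K"
    using compactin_PiE[of "\<lambda>_. euclidean" UNIV "\<lambda>i. PiE UNIV (\<lambda>j. cball (0::complex) (1 / sqrt (wt w i j)))"]
    by (simp add: euclidean_product_topology)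
  have Z: "?Z = (\<Inter>F\<in>Collect finite. {a. L2_set (wmod w a) F \<le> 1})"
    using HS_leI[of _ 1] L2_set_le_hs_norm by (fastforce intro: order_trans)
  have cont: "continuous_on UNIV (\<lambda>a::mat. a i j)" for i j
    using continuous_on_product_then_coordinatewise[OF continuous_on_product_coordinates] .
  have "closed ?Z"
    unfolding Z L2_set_def wmod_def case_prod_unfold
    by (intro closed_INT ballI closed_Collect_le continuous_intros cont)
  moreover have "?Z \<subseteq> ?K"
  proof
    fix a assume a: "a \<in> ?Z"
    have "cmod (a i j) \<le> 1 / sqrt (wt w i j)" for i j
      using a wmod_le_hs_norm[of a "(i, j)"] wt_pos[of i j] by (simp add: wmod_def field_simps)
    then show "a \<in> ?K" by auto
  qed
  then have "?K \<inter> ?Z = ?Z" by blast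
  ultimately show ?thesis
    using compact_Int_closed[OF K, of ?Z] by (simp only:)
qed

lemma dominated_tail_small:
  assumes Q: "dominated p Q" and e: "0 < e"
  obtains F where "finite F" "\<And>y. y \<in> HS w \<Longrightarrow> hs_norm w (Q (y - restr F y)) \<le> e * hs_norm w y"
proof -
  obtain B where B: "B \<ge> 0" "\<And>y m k. y \<in> HS w \<Longrightarrow> cmod (Q y (k + m) k) \<le> B * diag_l1 y (m + p)"
    using Q by (auto simp: dominated_def)
  \<comment> \<open>\<open>t\<close> is chosen to give \<open>B * sqrt (trS * t) \<le> e\<close>, and \<open>d\<close> below to give \<open>2 * sqrt (d * trS) = t\<close>\<close>
  define t where "t = (e / (B + 1))\<^sup>2 / trS"
  have t: "t > 0"
    using e B(1) trS_pos by (simp add: t_def)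
  have Bt: "B * sqrt (trS * t) \<le> e"
  proof -
    have "sqrt (trS * t) = e / (B + 1)"
      using e B(1) trS_pos by (simp add: t_def)
    moreover have "B * (e / (B + 1)) \<le> e"
      using e B(1) by (simp add: field_simps)
    ultimately show ?thesis by simp
  qed
  define d where "d = (t / 2)\<^sup>2 / trS"
  have d: "d > 0"
    using t trS_pos by (simp add: d_def)
  have dt: "2 * sqrt (d * trS) = t"
    using t trS_pos by (simp add: d_def)
  have "(\<lambda>k. norm (sval w k)) summable_on UNIV"
    using sval_summable less_imp_le[OF sval_pos] by simp
  then obtain F where F: "finite F" "(\<Sum>\<^sub>\<infinity>k\<in>UNIV - F. norm (sval w k)) < d"
    using infsum_abs_tail_small d by metis
  then have tail: "(\<Sum>\<^sub>\<infinity>k\<in>- F. sval w k) \<le> d"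
    using less_imp_le[OF sval_pos] by (simp add: Compl_eq_Diff_UNIV)
  have "hs_norm w (Q (y - restr F y)) \<le> e * hs_norm w y" if y: "y \<in> HS w" for y
  proof -
    let ?z = "y - restr F y"
    have z: "?z \<in> HS w" "hs_norm w ?z \<le> hs_norm w y"
      using wmod_nonneg by (auto intro!: wmod_mono_imp[OF y] simp: wmod_restr_compl)
    have l1: "(diag_l1 ?z m)\<^sup>2 \<le> t * diag_sq ?z m" for m
    proof -
      have "(diag_l1 ?z m)\<^sup>2 \<le> (\<Sum>\<^sub>\<infinity>k\<in>{k. (k + m, k) \<notin> F \<times> F}. wt w (k + m) k) * diag_sq ?z m"
        by (rule diag_l1_sq_le_on[OF z(1)]) (auto simp: restr_def)
      also have "\<dots> \<le> t * diag_sq ?z m"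
        using wt_diagonal_tail[OF tail, of m] diag_sq_nonneg by (intro mult_right_mono) (auto simp: dt)
      finally show ?thesis .
    qed
    have "hs_norm w (Q ?z) \<le> B * sqrt (trS * t) * hs_norm w ?z"
      using B t l1 z(1) by (intro HS_bound_of_diag_l1_bound(2)[where p = p]) auto
    also have "\<dots> \<le> e * hs_norm w y"
      using Bt z(2) e by (intro mult_mono) (auto simp: hs_norm_nonneg)
    finally show ?thesis .
  qed
  with F(1) that show thesis by blast
qed

text \<open>If \<open>y\<close> is entrywise close to \<open>x\<close>, the part of \<open>y - x\<close> inside a large square is small in norm,
  and the part outside has norm at most \<open>2\<close> but is almost annihilated by \<open>Q\<close>.\<close>

lemma dominated_continuous_pointwise:
  assumes Q: "dominated p Q"
  shows "continuous_map (top_of_set {a \<in> HS w. hs_norm w a \<le> 1}) (hs_top w) Q"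
  unfolding hs_top_def Metric_space.continuous_map_to_metric[OF Metric_space_HS]
proof (intro ballI allI impI)
  let ?Z = "{a \<in> HS w. hs_norm w a \<le> 1}"
  fix x and e :: real
  assume "x \<in> topspace (top_of_set ?Z)" and e: "0 < e"
  then have x: "x \<in> HS w" "hs_norm w x \<le> 1" by auto
  obtain F where F: "finite F" "\<And>y. y \<in> HS w \<Longrightarrow> hs_norm w (Q (y - restr F y)) \<le> e / 4 * hs_norm w y"
    using dominated_tail_small[OF Q, of "e / 4"] e by auto
  obtain C where C: "\<And>a. a \<in> HS w \<Longrightarrow> hs_norm w (Q a) \<le> C * hs_norm w a"
    using dominated_bounded[OF Q] by (auto simp: bounded_op_def)
  define D where "D = max C 0 + 1"
  have D: "D > 0" "C \<le> D"
    by (auto simp: D_def)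
  have QD: "hs_norm w (Q a) \<le> D * hs_norm w a" if "a \<in> HS w" for a
    using C[OF that] mult_right_mono[OF D(2) hs_norm_nonneg[of a]] by (rule order_trans)
  define U where "U = ?Z \<inter> {y. L2_set (wmod w (y - x)) (F \<times> F) < e / (2 * D)}"
  have cont: "continuous_on UNIV (\<lambda>a::mat. a i j)" for i j
    using continuous_on_product_then_coordinatewise[OF continuous_on_product_coordinates] .
  have "open {y. L2_set (wmod w (y - x)) (F \<times> F) < e / (2 * D)}"
    unfolding L2_set_def wmod_def case_prod_unfold fun_diff_def
    by (intro open_Collect_less continuous_intros cont)
  then have "openin (top_of_set ?Z) U"
    unfolding U_def by (rule openin_open_Int)
  moreover have "x \<in> U"
    using x e D(1) by (simp add: U_def wmod_def case_prod_unfold L2_set_def)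
  moreover have "Q y \<in> Metric_space.mball (HS w) (\<lambda>a b. hs_norm w (a - b)) (Q x) e" if "y \<in> U" for y
  proof -
    from that have y: "y \<in> HS w" "hs_norm w y \<le> 1" and yx: "L2_set (wmod w (y - x)) (F \<times> F) < e / (2 * D)"
      by (auto simp: U_def)
    let ?u = "y - x"
    have u: "?u \<in> HS w" using y x by (intro HS_diff)
    have "hs_norm w ?u \<le> hs_norm w y + hs_norm w (0 - x)"
      using hs_norm_triangle[OF y(1) HS_diff[OF HS_zero x(1)]] by simp
    then have u2: "hs_norm w ?u \<le> 2"
      using y x hs_norm_minus_commute[of 0 x] by simp
    have ur: "?u - restr F ?u \<in> HS w"
      by (intro HS_diff u hs_norm_restr F)
    have "Q y - Q x = Q ?u"
      using dominated_diff[OF Q y(1) x(1)] by simp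
    also have "Q ?u = Q ((?u - restr F ?u) + restr F ?u)" by simp
    also have "\<dots> = Q (?u - restr F ?u) + Q (restr F ?u)"
      using Q ur hs_norm_restr(1)[OF F(1)] unfolding dominated_def by blast
    finally have eq: "Q y - Q x = Q (?u - restr F ?u) + Q (restr F ?u)" .
    have 1: "hs_norm w (Q y - Q x) \<le> hs_norm w (Q (?u - restr F ?u)) + hs_norm w (Q (restr F ?u))"
      unfolding eq by (intro hs_norm_triangle dominated_HS[OF Q] ur hs_norm_restr(1) F(1))
    have "e / 4 * hs_norm w ?u \<le> e / 4 * 2"
      using u2 e by (intro mult_left_mono) auto
    with F(2)[OF u] have 2: "hs_norm w (Q (?u - restr F ?u)) \<le> e / 4 * 2"
      by (rule order_trans)
    have "hs_norm w (Q (restr F ?u)) \<le> D * L2_set (wmod w ?u) (F \<times> F)"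
      using QD[OF hs_norm_restr(1)[OF F(1)]] hs_norm_restr(2)[OF F(1)] by simp
    also have "\<dots> < D * (e / (2 * D))"
      using yx D(1) by (intro mult_strict_left_mono)
    also have "\<dots> = e / 2"
      using D(1) by simp
    finally have "hs_norm w (Q y - Q x) < e"
      using 1 2 by linarith
    then have "hs_norm w (Q x - Q y) < e"
      unfolding hs_norm_minus_commute[of "Q x"] .
    then show ?thesis
      using Metric_space.in_mball[OF Metric_space_HS] dominated_HS[OF Q] x y by blast
  qed
  ultimately show "\<exists>U. openin (top_of_set ?Z) U \<and> x \<in> U \<and>
      (\<forall>y\<in>U. Q y \<in> Metric_space.mball (HS w) (\<lambda>a b. hs_norm w (a - b)) (Q x) e)"
    by blast
qed

text \<open>The image of the whole unit ball is a continuous image of a compact set, hence compact and closed,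
  so it coincides with its closure.\<close>

lemma dominated_compact:
  assumes Q: "dominated p Q" shows "compact_op w Q"
proof -
  let ?Z = "{a \<in> HS w. hs_norm w a \<le> 1}"
  have "compactin (top_of_set ?Z) ?Z"
    using compact_unit_ball_pointwise by (simp add: compactin_subtopology)
  then have c: "compactin (hs_top w) (Q ` ?Z)"
    using dominated_continuous_pointwise[OF Q] by (rule image_compactin)
  moreover have "closedin (hs_top w) (Q ` ?Z)"
    using c Metric_space.Hausdorff_space_mtopology[OF Metric_space_HS]
    unfolding hs_top_def by (intro compactin_imp_closedin)
  ultimately show ?thesis
    using dominated_linear[OF Q] by (simp add: compact_op_def closure_of_closedin)
qed

end

section \<open>Subspaces spanned by matrices on single diagonals\<close>

lemma sum_mat_apply: "(\<Sum>m\<in>A. f m) i j = (\<Sum>m\<in>A. f m i j)" for f :: "'a \<Rightarrow> mat"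
  by (induction A rule: infinite_finite_induct) auto

lemma mat_eq_by_diagonals: "(a :: mat) = b \<longleftrightarrow> (\<forall>m k. a (k + m) k = b (k + m) k)"
proof
  assume *: "\<forall>m k. a (k + m) k = b (k + m) k"
  have "a i j = b i j" for i j
    using *[THEN spec, of "i - j", THEN spec, of j] by simp
  then show "a = b" by blast
qed simp

definition diag_vec :: "(int \<Rightarrow> int \<Rightarrow> real) \<Rightarrow> int \<Rightarrow> mat" where
  "diag_vec p m = (\<lambda>i j. if i = j + m then of_real (p m j) else 0)"

lemma diag_vec_diag: "diag_vec p m (k + n) k = (if n = m then of_real (p m k) else 0)"
  by (simp add: diag_vec_def)

text \<open>A finite family of bounded positive diagonals, one matrix for each diagonal in \<open>A\<close>. Such matrices
  are pairwise orthogonal, so the projection onto their span is an explicit finite sum. Both the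
  kernel and the cokernel of the d-bar operator are of this form.\<close>

locale diag_family = weighted_hs +
  fixes A :: "int set" and p :: "int \<Rightarrow> int \<Rightarrow> real"
  assumes finite_A: "finite A"
    and p_pos: "m \<in> A \<Longrightarrow> 0 < p m k"
    and p_bounded: "m \<in> A \<Longrightarrow> \<exists>b. \<forall>k. p m k \<le> b"
begin

abbreviation "dv \<equiv> diag_vec p"

definition V :: "mat set" where "V = mat.span (dv ` A)"

definition coef :: "mat \<Rightarrow> int \<Rightarrow> complex" where
  "coef a m = hs_inner w (dv m) a / hs_inner w (dv m) (dv m)"

definition proj :: "mat \<Rightarrow> mat" where
  "proj a = (\<Sum>m\<in>A. mscale (coef a m) (dv m))"

lemma comb_diag: "(\<Sum>m\<in>A. mscale (c m) (dv m)) (k + n) k = (if n \<in> A then c n * of_real (p n k) else 0)"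
  using finite_A
  by (simp add: sum_mat_apply mscale_def diag_vec_diag if_distrib[of "(*) _"] cong: if_cong)

lemma dv_HS: assumes m: "m \<in> A" shows "dv m \<in> HS w"
proof -
  obtain b where b: "\<And>k. p m k \<le> b" using p_bounded[OF m] by blast
  have inj: "inj (\<lambda>k. (k + m, k))" by (auto intro: injI)
  have "(\<lambda>k. wt w (k + m) k * (p m k)\<^sup>2) summable_on UNIV"
  proof (rule summable_on_comparison_test)
    show "(\<lambda>k. wt w (k + m) k * b\<^sup>2) summable_on UNIV"
      by (intro summable_on_cmult_left wt_diagonal_summable)
    show "wt w (k + m) k * (p m k)\<^sup>2 \<le> wt w (k + m) k * b\<^sup>2" for k
      using b less_imp_le[OF p_pos[OF m]] less_imp_le[OF wt_pos] by (intro mult_left_mono power_mono) auto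
  qed (use less_imp_le[OF wt_pos] in auto)
  then have "(\<lambda>x. (wmod w (dv m) x)\<^sup>2) summable_on range (\<lambda>k. (k + m, k))"
    by (subst summable_on_reindex[OF inj]) (simp add: o_def wmod_sq diag_vec_diag)
  then show ?thesis
    unfolding HS_iff
    by (subst summable_on_cong_neutral[where T = "range (\<lambda>k. (k + m, k))" and g = "\<lambda>x. (wmod w (dv m) x)\<^sup>2"])
       (auto simp: wmod_def diag_vec_def image_iff)
qed

lemma inner_dv:
  "hs_inner w (dv m) a = (\<Sum>\<^sub>\<infinity>k. of_real (wt w (k + m) k * p m k) * a (k + m) k)"
proof -
  have inj: "inj (\<lambda>k. (k + m, k))" by (auto intro: injI)
  let ?f = "\<lambda>(i, j). complex_of_real (wt w i j) * (cnj (dv m i j) * a i j)"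
  have "hs_inner w (dv m) a = infsum ?f (range (\<lambda>k. (k + m, k)))"
    unfolding hs_inner_eq
    by (rule infsum_cong_neutral) (auto simp: diag_vec_def image_iff)
  also have "\<dots> = (\<Sum>\<^sub>\<infinity>k. ?f (k + m, k))"
    by (subst infsum_reindex[OF inj]) (simp add: o_def)
  finally show ?thesis
    by (simp add: diag_vec_diag mult_ac)
qed

lemma inner_dv_bound:
  assumes m: "m \<in> A"
  shows "\<exists>b\<ge>0. \<forall>a\<in>HS w. cmod (hs_inner w (dv m) a) \<le> b * diag_l1 a m"
proof -
  obtain b where b: "\<And>k. p m k \<le> b" using p_bounded[OF m] by blast
  have b0: "0 \<le> b" using b[of 0] p_pos[OF m, of 0] by linarith
  have "cmod (hs_inner w (dv m) a) \<le> b * diag_l1 a m" if a: "a \<in> HS w" for a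
  proof -
    have le: "cmod (of_real (wt w (k + m) k * p m k) * a (k + m) k) \<le> b * (wt w (k + m) k * cmod (a (k + m) k))" for k
    proof -
      have "cmod (of_real (wt w (k + m) k * p m k) * a (k + m) k) = p m k * (wt w (k + m) k * cmod (a (k + m) k))"
        using wt_pos[of "k + m" k] p_pos[OF m, of k] by (simp add: norm_mult)
      also have "\<dots> \<le> b * (wt w (k + m) k * cmod (a (k + m) k))"
        using b less_imp_le[OF wt_pos] by (intro mult_right_mono) auto
      finally show ?thesis .
    qed
    have s: "(\<lambda>k. b * (wt w (k + m) k * cmod (a (k + m) k))) summable_on UNIV"
      by (intro summable_on_cmult_right diag_l1_summable a)
    have s': "(\<lambda>k. cmod (of_real (wt w (k + m) k * p m k) * a (k + m) k)) summable_on UNIV"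
      using s le by (rule summable_on_comparison_test) auto
    have "cmod (hs_inner w (dv m) a) \<le> (\<Sum>\<^sub>\<infinity>k. cmod (of_real (wt w (k + m) k * p m k) * a (k + m) k))"
      unfolding inner_dv using s' by (rule norm_infsum_bound)
    also have "\<dots> \<le> (\<Sum>\<^sub>\<infinity>k. b * (wt w (k + m) k * cmod (a (k + m) k)))"
      using s' s le by (rule infsum_mono)
    also have "\<dots> = b * diag_l1 a m"
      by (simp add: diag_l1_def infsum_cmult_right')
    finally show ?thesis .
  qed
  with b0 show ?thesis by blast
qed

lemma dv_orthogonal: "m \<noteq> n \<Longrightarrow> hs_inner w (dv m) (dv n) = 0"
  by (simp add: inner_dv diag_vec_diag)

lemma dv_inner_self_nonzero: assumes m: "m \<in> A" shows "hs_inner w (dv m) (dv m) \<noteq> 0"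
proof -
  have "dv m (0 + m) 0 \<noteq> 0"
    unfolding diag_vec_diag using p_pos[OF m, of 0] by simp
  then have "dv m \<noteq> 0" by force
  then show ?thesis
    using hs_norm_zero_iff[OF dv_HS[OF m]] by (simp add: hs_norm_sq_eq_inner)
qed

lemma inner_dv_proj: "n \<in> A \<Longrightarrow> hs_inner w (dv n) (proj a) = hs_inner w (dv n) a"
proof -
  assume n: "n \<in> A"
  have "hs_inner w (dv n) (proj a) = (\<Sum>m\<in>A. coef a m * hs_inner w (dv n) (dv m))"
    unfolding proj_def
    by (subst hs_inner_sum_right) (auto simp: dv_HS n HS_mscale hs_inner_mscale_right)
  also have "\<dots> = (\<Sum>m\<in>A. if m = n then hs_inner w (dv n) a else 0)"
    using dv_inner_self_nonzero[OF n] by (intro sum.cong) (auto simp: dv_orthogonal coef_def)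
  finally show ?thesis using n finite_A by simp
qed

lemma dominated_proj: "dominated 0 proj"
  unfolding dominated_def
proof (intro conjI ballI allI)
  fix y z assume y: "y \<in> HS w" "z \<in> HS w"
  have "coef (y + z) m = coef y m + coef z m" if "m \<in> A" for m
    unfolding coef_def by (subst hs_inner_add_right) (auto simp: y dv_HS that add_divide_distrib)
  then show "proj (y + z) = proj y + proj z"
    unfolding proj_def sum.distrib[symmetric]
    by (intro sum.cong) (auto simp: mat.scale_left_distrib[symmetric] simp del: plus_fun_apply)
next
  fix c y
  show "proj (mscale c y) = mscale c (proj y)"
    by (simp add: proj_def mat.scale_sum_right coef_def hs_inner_mscale_right)
next
  obtain b where b: "\<And>m k. m \<in> A \<Longrightarrow> p m k \<le> b m"
    using p_bounded by metis
  obtain c where c: "\<And>m. m \<in> A \<Longrightarrow> 0 \<le> c m"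
      "\<And>m a. m \<in> A \<Longrightarrow> a \<in> HS w \<Longrightarrow> cmod (hs_inner w (dv m) a) \<le> c m * diag_l1 a m"
    using inner_dv_bound by metis
  define d where "d m = c m / cmod (hs_inner w (dv m) (dv m)) * b m" for m
  have b0: "0 \<le> b m" if "m \<in> A" for m
    using b[OF that, of 0] p_pos[OF that, of 0] by linarith
  have d: "0 \<le> d m" if "m \<in> A" for m
    using b0[OF that] c(1)[OF that] by (simp add: d_def)
  have "cmod (proj y (k + m) k) \<le> sum d A * diag_l1 y (m + 0)" if y: "y \<in> HS w" for y m k
  proof (cases "m \<in> A")
    case True
    have "cmod (proj y (k + m) k) = cmod (coef y m) * p m k"
      using True less_imp_le[OF p_pos[OF True]] by (simp add: proj_def comb_diag norm_mult)
    also have "\<dots> \<le> (c m * diag_l1 y m / cmod (hs_inner w (dv m) (dv m))) * b m"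
      using b[OF True] less_imp_le[OF p_pos[OF True]] c[OF True] y diag_l1_nonneg
      by (intro mult_mono) (auto simp: coef_def norm_divide divide_right_mono)
    also have "\<dots> = d m * diag_l1 y m"
      by (simp add: d_def)
    also have "\<dots> \<le> sum d A * diag_l1 y m"
      using True d finite_A by (intro mult_right_mono diag_l1_nonneg member_le_sum) auto
    finally show ?thesis by simp
  next
    case False
    then show ?thesis
      using d diag_l1_nonneg by (simp add: proj_def comb_diag sum_nonneg)
  qed
  then show "\<exists>B\<ge>0. \<forall>y\<in>HS w. \<forall>m k. cmod (proj y (k + m) k) \<le> B * diag_l1 y (m + 0)"
    using d by (intro exI[of _ "sum d A"]) (auto simp: sum_nonneg)
qed

lemma proj_HS: "a \<in> HS w \<Longrightarrow> proj a \<in> HS w"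
  by (rule dominated_HS[OF dominated_proj])

lemma comb_in_V: "(\<Sum>m\<in>A. mscale (c m) (dv m)) \<in> V"
  unfolding V_def by (intro mat.span_sum mat.span_scale) (auto intro: mat.span_base)

lemma V_iff: "v \<in> V \<longleftrightarrow> (\<exists>c. \<forall>m k. v (k + m) k = (if m \<in> A then c m * of_real (p m k) else 0))"
proof
  let ?S = "{v. \<exists>c. \<forall>m k. v (k + m) k = (if m \<in> A then c m * complex_of_real (p m k) else 0)}"
  have "mat.subspace ?S"
    unfolding mat.subspace_def
  proof (intro conjI allI impI ballI)
    fix u v assume "u \<in> ?S" "v \<in> ?S"
    then obtain c d where "\<forall>m k. u (k + m) k = (if m \<in> A then c m * complex_of_real (p m k) else 0)"
      "\<forall>m k. v (k + m) k = (if m \<in> A then d m * complex_of_real (p m k) else 0)" by blast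
    then show "u + v \<in> ?S"
      by (intro CollectI exI[of _ "\<lambda>m. c m + d m"]) (auto simp: algebra_simps)
  next
    fix r v assume "v \<in> ?S"
    then obtain c where "\<forall>m k. v (k + m) k = (if m \<in> A then c m * complex_of_real (p m k) else 0)"
      by blast
    then show "mscale r v \<in> ?S"
      by (intro CollectI exI[of _ "\<lambda>m. r * c m"]) (auto simp: mscale_def)
  qed (auto intro: exI[of _ "\<lambda>_. 0"])
  moreover have "dv ` A \<subseteq> ?S"
  proof
    fix v assume "v \<in> dv ` A"
    then obtain m where "v = dv m" "m \<in> A" by blast
    then show "v \<in> ?S"
      by (intro CollectI exI[of _ "\<lambda>n. if n = m then 1 else 0"]) (auto simp: diag_vec_diag)
  qed
  ultimately have "V \<subseteq> ?S"
    unfolding V_def by (intro mat.span_minimal)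
  then show "v \<in> V \<Longrightarrow> \<exists>c. \<forall>m k. v (k + m) k = (if m \<in> A then c m * of_real (p m k) else 0)"
    by blast
next
  assume "\<exists>c. \<forall>m k. v (k + m) k = (if m \<in> A then c m * of_real (p m k) else 0)"
  then obtain c where "v = (\<Sum>m\<in>A. mscale (c m) (dv m))"
    unfolding mat_eq_by_diagonals comb_diag by blast
  then show "v \<in> V"
    by (simp only: comb_in_V)
qed

lemma V_comb: assumes "v \<in> V" obtains c where "v = (\<Sum>m\<in>A. mscale (c m) (dv m))"
  using assms unfolding V_iff mat_eq_by_diagonals comb_diag by blast

lemma subspace_V: "mat.subspace V"
  unfolding V_def by simp

lemma V_HS: "V \<subseteq> HS w"
  unfolding V_def by (intro mat.span_minimal subspace_HS) (auto simp: dv_HS)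

lemma proj_in_V: "proj a \<in> V"
  unfolding proj_def by (rule comb_in_V)

lemma proj_eq_zero_iff: "proj a = 0 \<longleftrightarrow> (\<forall>m\<in>A. hs_inner w (dv m) a = 0)"
proof
  assume "proj a = 0"
  then show "\<forall>m\<in>A. hs_inner w (dv m) a = 0"
    using inner_dv_proj[of _ a] by (auto simp: hs_inner_zero_right)
qed (simp add: proj_def coef_def)

lemma orth_compl_V: "orth_compl w V = {b \<in> HS w. proj b = 0}"
proof -
  have "(\<forall>v\<in>V. hs_inner w v b = 0) \<longleftrightarrow> (\<forall>m\<in>A. hs_inner w (dv m) b = 0)" if b: "b \<in> HS w" for b
  proof
    assume *: "\<forall>m\<in>A. hs_inner w (dv m) b = 0"
    show "\<forall>v\<in>V. hs_inner w v b = 0"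
    proof
      fix v assume "v \<in> V"
      then obtain c where v: "v = (\<Sum>m\<in>A. mscale (c m) (dv m))"
        by (rule V_comb)
      have "hs_inner w b v = (\<Sum>m\<in>A. c m * hs_inner w b (dv m))"
        unfolding v
        by (subst hs_inner_sum_right) (auto simp: b dv_HS HS_mscale hs_inner_mscale_right)
      also have "\<dots> = 0"
        using * by (intro sum.neutral) (simp add: hs_inner_commute[of b])
      finally show "hs_inner w v b = 0"
        by (simp add: hs_inner_commute[of v])
    qed
  qed (auto simp: V_def mat.span_base)
  then show ?thesis
    by (auto simp: orth_compl_def proj_eq_zero_iff)
qed

lemma proj_diff: "a \<in> HS w \<Longrightarrow> b \<in> HS w \<Longrightarrow> proj (a - b) = proj a - proj b"
  by (rule dominated_diff[OF dominated_proj])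

lemma orth_compl_inter: "v \<in> V \<Longrightarrow> v \<in> orth_compl w V \<Longrightarrow> v = 0"
  using hs_norm_zero_iff V_HS hs_norm_sq_eq_inner[of v] by (auto simp: orth_compl_def)

lemma diff_proj_orth: "a \<in> HS w \<Longrightarrow> a - proj a \<in> orth_compl w V"
  by (simp add: orth_compl_V HS_diff proj_HS proj_eq_zero_iff hs_inner_diff_right dv_HS inner_dv_proj)

lemma subspace_orth_compl: "mat.subspace (orth_compl w V)"
  using dominated_proj unfolding orth_compl_V
  by (auto simp: mat.subspace_def HS_zero HS_add HS_mscale dominated_def proj_eq_zero_iff hs_inner_zero_right
      hs_inner_add_right dv_HS hs_inner_mscale_right simp del: plus_fun_apply)

lemma orth_proj_eq: assumes a: "a \<in> HS w" shows "orth_proj w V a = proj a"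
  unfolding orth_proj_def
proof (rule the_equality)
  show "proj a \<in> V \<and> a - proj a \<in> orth_compl w V"
    using proj_in_V diff_proj_orth[OF a] by blast
  fix v assume v: "v \<in> V \<and> a - v \<in> orth_compl w V"
  have "v - proj a \<in> V"
    using v proj_in_V by (intro mat.subspace_diff[OF subspace_V]) auto
  moreover have "(a - proj a) - (a - v) \<in> orth_compl w V"
    using v diff_proj_orth[OF a] mat.subspace_diff[OF subspace_orth_compl] by blast
  ultimately have "v - proj a = 0"
    by (intro orth_compl_inter) simp_all
  then show "v = proj a" by simp
qed

lemma proj_V: "v \<in> V \<Longrightarrow> proj v = v"
  using orth_compl_inter[of "v - proj v"] diff_proj_orth[of v] V_HS
    mat.subspace_diff[OF subspace_V, of v "proj v"] proj_in_V by auto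

lemma V_iff_proj: "v \<in> V \<longleftrightarrow> proj v = v"
  using proj_V proj_in_V by metis

text \<open>The orthogonal complement of a range is the cokernel; since the range will be identified as
  \<open>orth_compl w V\<close>, this lemma computes the cokernel.\<close>

lemma double_orth_compl: "orth_compl w (orth_compl w V) = V"
proof
  show "V \<subseteq> orth_compl w (orth_compl w V)"
  proof
    fix v assume v: "v \<in> V"
    have "hs_inner w b v = 0" if "b \<in> orth_compl w V" for b
      using that v by (auto simp: orth_compl_def hs_inner_commute[of b])
    then show "v \<in> orth_compl w (orth_compl w V)"
      using v V_HS by (auto simp: orth_compl_def)
  qed
  show "orth_compl w (orth_compl w V) \<subseteq> V"
  proof
    fix y assume y: "y \<in> orth_compl w (orth_compl w V)"
    then have yH: "y \<in> HS w" by (simp add: orth_compl_def)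
    let ?z = "y - proj y"
    have z: "?z \<in> orth_compl w V" by (rule diff_proj_orth[OF yH])
    have zH: "?z \<in> HS w" using z by (simp add: orth_compl_def)
    have "hs_inner w ?z y = 0"
      using y z by (auto simp: orth_compl_def)
    moreover have "hs_inner w ?z (proj y) = 0"
      using z proj_in_V[of y] by (simp add: orth_compl_def hs_inner_commute[of ?z])
    ultimately have "hs_inner w ?z ?z = 0"
      using hs_inner_diff_right[OF zH yH proj_HS[OF yH]] by simp
    then have "?z = 0"
      using hs_norm_zero_iff[OF zH] hs_norm_sq_eq_inner[of ?z] by simp
    then show "y \<in> V"
      using proj_in_V[of y] by simp
  qed
qed

lemma inj_dv: "inj_on dv A"
proof (rule inj_onI)
  fix m n assume mn: "m \<in> A" "n \<in> A" "dv m = dv n"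
  then have "dv n (0 + m) 0 \<noteq> 0"
    using p_pos[OF mn(1), of 0] diag_vec_diag[of p m 0 m] by simp
  then show "m = n"
    unfolding diag_vec_diag by (simp split: if_splits)
qed

lemma finite_dim_V: "finite_dim V"
  using finite_A by (auto simp: finite_dim_def V_def)

lemma dim_V: "mat.dim V = card A"
proof -
  have "mat.independent (dv ` A)"
  proof (rule mat.independent_if_scalars_zero)
    fix f x assume f: "(\<Sum>x\<in>dv ` A. mscale (f x) x) = 0" and "x \<in> dv ` A"
    then obtain m where m: "m \<in> A" "x = dv m" by blast
    have "(\<Sum>n\<in>A. mscale (f (dv n)) (dv n)) = 0"
      using f by (simp add: sum.reindex[OF inj_dv])
    then have "(\<Sum>n\<in>A. mscale (f (dv n)) (dv n)) (0 + m) 0 = 0"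
      by simp
    then show "f x = 0"
      unfolding comb_diag using m p_pos[OF m(1), of 0] by simp
  qed (use finite_A in simp)
  then show ?thesis
    unfolding V_def using card_image[OF inj_dv] by (simp add: mat.dim_eq_card_independent)
qed

end

section \<open>Fredholm operators with a dominated right inverse\<close>

context weighted_hs begin

text \<open>Closedness of graphs and ranges is tested entry by entry, each entry being a continuous
  functional.\<close>

lemma continuous_functional:
  fixes f :: "mat \<Rightarrow> complex"
  assumes d: "\<And>a b. a \<in> HS w \<Longrightarrow> b \<in> HS w \<Longrightarrow> f (a - b) = f a - f b"
    and B: "\<And>a. a \<in> HS w \<Longrightarrow> cmod (f a) \<le> B * hs_norm w a"
  shows "continuous_map (hs_top w) euclidean f"
  unfolding hs_top_def Metric_space.continuous_map_from_metric[OF Metric_space_HS]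
proof (intro conjI ballI allI impI)
  fix a U assume a: "a \<in> HS w" and "openin euclidean U \<and> f a \<in> U"
  then obtain e where e: "0 < e" "ball (f a) e \<subseteq> U"
    by (metis open_contains_ball open_openin)
  define r where "r = e / (\<bar>B\<bar> + 1)"
  have r: "0 < r" using e by (simp add: r_def)
  have "f x \<in> U" if x: "x \<in> HS w" "hs_norm w (a - x) < r" for x
  proof -
    have "cmod (f a - f x) \<le> B * hs_norm w (a - x)"
      using B[OF HS_diff[OF a x(1)]] d[OF a x(1)] by simp
    also have "\<dots> \<le> (\<bar>B\<bar> + 1) * hs_norm w (a - x)"
      by (intro mult_right_mono hs_norm_nonneg) auto
    also have "\<dots> < (\<bar>B\<bar> + 1) * r"
      using x(2) by (intro mult_strict_left_mono) auto
    also have "\<dots> = e" by (simp add: r_def)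
    finally show ?thesis using e(2) by (auto simp: dist_norm)
  qed
  then show "\<exists>r>0. \<forall>x. x \<in> HS w \<and> hs_norm w (a - x) < r \<longrightarrow> f x \<in> U"
    using r by blast
qed auto

lemma continuous_entry: "continuous_map (hs_top w) euclidean (\<lambda>a. a i j)"
proof (rule continuous_functional[where B = "1 / sqrt (wt w i j)"])
  fix a assume "a \<in> HS w"
  then show "cmod (a i j) \<le> 1 / sqrt (wt w i j) * hs_norm w a"
    using wmod_le_hs_norm[of a "(i, j)"] wt_pos[of i j] by (simp add: wmod_def field_simps)
qed simp

lemma dominated_continuous_entry:
  assumes Q: "dominated q Q" shows "continuous_map (hs_top w) euclidean (\<lambda>a. Q a i j)"
proof -
  obtain B where B: "B \<ge> 0" "\<And>y m k. y \<in> HS w \<Longrightarrow> cmod (Q y (k + m) k) \<le> B * diag_l1 y (m + q)"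
    using Q by (auto simp: dominated_def)
  have "cmod (Q a i j) \<le> B * sqrt trS * hs_norm w a" if "a \<in> HS w" for a
    using B(2)[OF that, of j "i - j"]
      mult_left_mono[OF diag_l1_le_hs_norm[OF that, of "i - j + q"] B(1)] by (simp add: mult.assoc)
  then show ?thesis
    using dominated_diff[OF Q] by (intro continuous_functional[where B = "B * sqrt trS"]) auto
qed

end

text \<open>The algebra that turns a right inverse \<open>R\<close> of \<open>T\<close> into a parametrix. The map \<open>T\<close> acts on all
  matrices, and \<open>K.V\<close> and \<open>C.V\<close> are the prospective kernel and cokernel. Boundary conditions are
  encoded only through these two subspaces, in the definition of \<open>domT\<close>.\<close>

locale parametrix = weighted_hs w + K: diag_family w A p + C: diag_family w A' p'
  for w A p A' p' +
  fixes T R :: "mat \<Rightarrow> mat" and q :: int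
  assumes T_add: "T (a + b) = T a + T b"
    and T_mscale: "T (mscale c a) = mscale c (T a)"
    and R_dominated: "dominated q R"
    and T_R: "y \<in> HS w \<Longrightarrow> T (R y) = y"
    and T_K: "v \<in> K.V \<Longrightarrow> T v = 0"
begin

text \<open>Equivalently, the matrices \<open>R y + v\<close> with \<open>y\<close> in \<open>HS w\<close>, \<open>C.proj y = 0\<close> and \<open>v\<close> in \<open>K.V\<close>; see
  \<open>R_plus_K_in_domT\<close> and \<open>domT_cases\<close>. This form makes it a subspace.\<close>

definition domT :: "mat set" where
  "domT = {a \<in> HS w. T a \<in> HS w \<and> C.proj (T a) = 0 \<and> a - R (T a) \<in> K.V}"

text \<open>\<open>R (1 - C.proj)\<close>, expanded because the identity is not a dominated operator while both terms are.\<close>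

definition R_perp :: "mat \<Rightarrow> mat" where "R_perp y = R y - R (C.proj y)"

definition Q :: "mat \<Rightarrow> mat" where "Q y = R_perp y - K.proj (R_perp y)"

lemma R_HS: "y \<in> HS w \<Longrightarrow> R y \<in> HS w"
  by (rule dominated_HS[OF R_dominated])

lemma R_diff: "y \<in> HS w \<Longrightarrow> z \<in> HS w \<Longrightarrow> R (y - z) = R y - R z"
  by (rule dominated_diff[OF R_dominated])

lemma R_zero: "R 0 = 0"
  using R_diff[OF HS_zero HS_zero] by simp

lemma R_perp_eq: "y \<in> HS w \<Longrightarrow> R_perp y = R (y - C.proj y)"
  by (simp add: R_perp_def R_diff C.proj_HS)

lemma R_perp_dominated: "dominated q R_perp"
  using dominated_minus[OF R_dominated dominated_compose[OF R_dominated C.dominated_proj, simplified]]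
  unfolding R_perp_def[abs_def] .

lemma Q_dominated: "dominated q Q"
  using dominated_minus[OF R_perp_dominated dominated_compose[OF K.dominated_proj R_perp_dominated, simplified]]
  unfolding Q_def[abs_def] .

lemma C_proj_zero: "C.proj 0 = 0"
  using C.proj_diff[OF HS_zero HS_zero] by simp

lemma C_proj_idem: "y \<in> HS w \<Longrightarrow> C.proj (y - C.proj y) = 0"
  using C.diff_proj_orth[of y] by (simp add: C.orth_compl_V)

lemma R_plus_K_in_domT:
  assumes y: "y \<in> HS w" "C.proj y = 0" and v: "v \<in> K.V"
  shows "R y + v \<in> domT" "T (R y + v) = y"
proof -
  show T: "T (R y + v) = y"
    by (simp only: T_add T_R[OF y(1)] T_K[OF v] add_0_right)
  show "R y + v \<in> domT"
    unfolding domT_def mem_Collect_eq T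
    using y v K.V_HS HS_add[OF R_HS[OF y(1)]] by (simp add: subset_iff del: plus_fun_apply)
qed

lemma domT_cases:
  assumes "a \<in> domT"
  obtains v where "v \<in> K.V" "a = R (T a) + v" "T a \<in> HS w" "C.proj (T a) = 0"
  using assms that[of "a - R (T a)"] by (simp add: domT_def)

lemma domT_subset: "domT \<subseteq> HS w"
  by (auto simp: domT_def)

lemma subspace_domT: "mat.subspace domT"
  unfolding mat.subspace_def
proof (intro conjI ballI allI)
  show "0 \<in> domT"
    using R_plus_K_in_domT(1)[OF HS_zero C_proj_zero mat.subspace_0[OF K.subspace_V]] by (simp add: R_zero)
  fix a assume "a \<in> domT"
  then obtain u where u: "u \<in> K.V" "a = R (T a) + u" "T a \<in> HS w" "C.proj (T a) = 0"
    by (rule domT_cases)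
  {
    fix b assume "b \<in> domT"
    then obtain v where v: "v \<in> K.V" "b = R (T b) + v" "T b \<in> HS w" "C.proj (T b) = 0"
      by (rule domT_cases)
    have "C.proj (T a + T b) = C.proj (T a) + C.proj (T b)" "R (T a + T b) = R (T a) + R (T b)"
      using C.dominated_proj R_dominated u(3) v(3) by (simp_all add: dominated_def)
    then have "R (T a) + R (T b) + (u + v) \<in> domT"
      using R_plus_K_in_domT(1)[OF HS_add[OF u(3) v(3)] _ mat.subspace_add[OF K.subspace_V u(1) v(1)]] u(4) v(4)
      by (simp del: plus_fun_apply)
    moreover have "R (T a) + R (T b) + (u + v) = (R (T a) + u) + (R (T b) + v)"
      by (simp only: add_ac)
    ultimately show "a + b \<in> domT"
      using u(2) v(2) by simp
  next
    fix c
    have "C.proj (mscale c (T a)) = mscale c (C.proj (T a))" "R (mscale c (T a)) = mscale c (R (T a))"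
      using C.dominated_proj R_dominated u(3) by (simp_all add: dominated_def)
    then have "mscale c (R (T a)) + mscale c u \<in> domT"
      using R_plus_K_in_domT(1)[OF HS_mscale[OF u(3)] _ mat.subspace_scale[OF K.subspace_V u(1)]] u(4)
      by (metis mat.scale_zero_right)
    then show "mscale c a \<in> domT"
      using u(2) by (metis mat.scale_right_distrib)
  }
qed

lemma range_T: "T ` domT = orth_compl w C.V"
proof
  show "T ` domT \<subseteq> orth_compl w C.V"
    by (auto simp: domT_def C.orth_compl_V)
  show "orth_compl w C.V \<subseteq> T ` domT"
  proof
    fix y assume "y \<in> orth_compl w C.V"
    then have "R y + 0 \<in> domT" "T (R y + 0) = y"
      using R_plus_K_in_domT[of y 0] mat.subspace_0[OF K.subspace_V] by (auto simp: C.orth_compl_V)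
    then show "y \<in> T ` domT" by (metis imageI)
  qed
qed

lemma ker_T: "op_ker domT T = K.V"
  using K.V_HS by (auto simp: op_ker_def domT_def T_K R_zero C_proj_zero HS_zero)

lemma coker_T: "op_coker w domT T = C.V"
  by (simp add: op_coker_def range_T C.double_orth_compl)

lemma unbounded_op_T: "unbounded_op w domT T"
  using subspace_domT by (auto simp: unbounded_op_def linear_between_def domT_def T_add T_mscale)

lemma closed_range_T: "closedin (hs_top w) (T ` domT)"
proof -
  have "T ` domT = (\<Inter>(i, j)\<in>UNIV. {b \<in> topspace (hs_top w). C.proj b i j = 0})"
    unfolding range_T C.orth_compl_V topspace_hs_top by (auto simp: fun_eq_iff)
  moreover have "closedin (hs_top w) {b \<in> topspace (hs_top w). C.proj b i j = 0}" for i j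
    by (intro closedin_continuous_maps_eq[where Y = euclidean] dominated_continuous_entry[OF C.dominated_proj]) auto
  ultimately show ?thesis
    by (auto intro!: closedin_INT)
qed

text \<open>A pair \<open>(a, b)\<close> lies in the graph iff \<open>C.proj b = 0\<close> and \<open>a - R b\<close> is fixed by \<open>K.proj\<close>. These are
  equations between continuous functionals of \<open>(a, b)\<close>, in which the unbounded \<open>T\<close> does not occur.\<close>

lemma closed_op_T: "closed_op w domT T"
proof -
  let ?P = "prod_topology (hs_top w) (hs_top w)"
  let ?S = "\<lambda>i j. {x \<in> topspace ?P. C.proj (snd x) i j = 0} \<inter>
    {x \<in> topspace ?P. fst x i j - K.proj (fst x) i j = R (snd x) i j - K.proj (R (snd x)) i j}"
  have graph: "(a, b) \<in> (\<lambda>a. (a, T a)) ` domT \<longleftrightarrow> a \<in> HS w \<and> b \<in> HS w \<and> C.proj b = 0 \<and>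
      a - K.proj a = R b - K.proj (R b)" for a b
  proof (cases "a \<in> HS w \<and> b \<in> HS w \<and> C.proj b = 0")
    case True
    then have ab: "a \<in> HS w" "b \<in> HS w" "C.proj b = 0" "R b \<in> HS w"
      by (auto simp: R_HS)
    have "a - K.proj a = R b - K.proj (R b) \<longleftrightarrow> a - R b \<in> K.V"
      unfolding K.V_iff_proj K.proj_diff[OF ab(1,4)] by (auto simp: algebra_simps)
    also have "\<dots> \<longleftrightarrow> (a, b) \<in> (\<lambda>a. (a, T a)) ` domT"
    proof
      assume v: "a - R b \<in> K.V"
      then show "(a, b) \<in> (\<lambda>a. (a, T a)) ` domT"
        using R_plus_K_in_domT[OF ab(2,3) v] by (auto simp: image_iff)
    qed (auto simp: domT_def)
    finally show ?thesis using ab by simp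
  qed (auto simp: domT_def)
  have "(\<lambda>a. (a, T a)) ` domT = (\<Inter>(i, j)\<in>UNIV. ?S i j)"
    (is "?G = ?I")
  proof (rule set_eqI)
    fix x :: "mat \<times> mat"
    obtain a b where x: "x = (a, b)" by fastforce
    show "x \<in> ?G \<longleftrightarrow> x \<in> ?I"
      unfolding x graph by (auto simp: topspace_hs_top fun_eq_iff)
  qed
  moreover have "closedin ?P (?S i j)" for i j
  proof -
    have fst: "continuous_map ?P euclidean (\<lambda>x. f (fst x))" and snd: "continuous_map ?P euclidean (\<lambda>x. f (snd x))"
      if "continuous_map (hs_top w) euclidean f" for f :: "mat \<Rightarrow> complex"
      using continuous_map_compose[OF continuous_map_fst that] continuous_map_compose[OF continuous_map_snd that]
      by (simp_all add: o_def)
    have KR: "dominated q (\<lambda>y. K.proj (R y))"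
      using dominated_compose[OF K.dominated_proj R_dominated] by simp
    show ?thesis
      by (intro closedin_Int closedin_continuous_maps_eq[where Y = euclidean] continuous_map_diff
          fst[OF continuous_entry] fst[OF dominated_continuous_entry[OF K.dominated_proj]]
          snd[OF dominated_continuous_entry[OF C.dominated_proj]]
          snd[OF dominated_continuous_entry[OF R_dominated]] snd[OF dominated_continuous_entry[OF KR]]) auto
  qed
  ultimately show ?thesis
    unfolding closed_op_def by (auto intro!: closedin_INT)
qed

lemma fredholm_T: "densely_defined w domT \<Longrightarrow> fredholm_op w domT T"
  by (simp add: fredholm_op_def unbounded_op_T closed_op_T closed_range_T ker_T coker_T
      K.finite_dim_V C.finite_dim_V)

lemma index_T: "op_index w domT T = int (card A) - int (card A')"
  by (simp add: op_index_def ker_T coker_T K.dim_V C.dim_V)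

lemma Q_in_domT:
  assumes y: "y \<in> HS w"
  shows "Q y \<in> domT" "T (Q y) = y - C.proj y"
proof -
  let ?z = "y - C.proj y" and ?v = "- K.proj (R_perp y)"
  have z: "?z \<in> HS w" "C.proj ?z = 0"
    using y by (simp_all add: HS_diff C.proj_HS C_proj_idem)
  have v: "?v \<in> K.V"
    by (intro mat.subspace_neg[OF K.subspace_V] K.proj_in_V)
  have eq: "Q y = R ?z + ?v"
    by (simp add: Q_def R_perp_eq[OF y])
  show "Q y \<in> domT" "T (Q y) = ?z"
    unfolding eq by (rule R_plus_K_in_domT[OF z v])+
qed

lemma Q_T:
  assumes a: "a \<in> domT"
  shows "Q (T a) = a - K.proj a"
proof -
  obtain v where v: "v \<in> K.V" "a = R (T a) + v" "T a \<in> HS w" "C.proj (T a) = 0"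
    using a by (rule domT_cases)
  have R: "R (T a) = a - v"
    using v(2) by (metis add_diff_cancel_right')
  have aH: "a \<in> HS w" "v \<in> HS w"
    using a domT_subset v(1) K.V_HS by auto
  have "R_perp (T a) = R (T a)"
    by (simp add: R_perp_def v(4) R_zero)
  then show ?thesis
    by (simp add: Q_def R K.proj_diff[OF aH] K.proj_V[OF v(1)])
qed

lemma ker_Q: "op_ker (HS w) Q = C.V"
proof (rule set_eqI)
  fix y
  show "y \<in> op_ker (HS w) Q \<longleftrightarrow> y \<in> C.V"
  proof
    assume "y \<in> op_ker (HS w) Q"
    then have y: "y \<in> HS w" "Q y = 0" by (auto simp: op_ker_def)
    then have "y - C.proj y = T 0"
      using Q_in_domT(2)[OF y(1)] by simp
    also have "T 0 = 0"
      using T_K mat.subspace_0[OF K.subspace_V] by blast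
    finally show "y \<in> C.V"
      by (simp add: C.V_iff_proj)
  next
    assume y: "y \<in> C.V"
    then have "R_perp y = 0"
      by (simp add: R_perp_def C.proj_V)
    then have "Q y = 0"
      using K.proj_diff[OF HS_zero HS_zero] by (simp add: Q_def)
    then show "y \<in> op_ker (HS w) Q"
      using y C.V_HS by (auto simp: op_ker_def)
  qed
qed

theorem Q_is_parametrix:
  "bounded_op w Q \<and> op_ker (HS w) Q = op_coker w domT T \<and>
    (\<forall>a\<in>HS w. Q a \<in> domT \<and> T (Q a) = a - orth_proj w (op_coker w domT T) a) \<and>
    (\<forall>a\<in>domT. Q (T a) = a - orth_proj w (op_ker domT T) a) \<and> compact_op w Q"
  using domT_subset
  by (auto simp: dominated_bounded[OF Q_dominated] dominated_compact[OF Q_dominated] ker_Q ker_T coker_T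
      Q_in_domT Q_T C.orth_proj_eq K.orth_proj_eq)

end

section \<open>Boundary values\<close>

lemma int_mono_stepI:
  fixes f :: "int \<Rightarrow> real"
  assumes "\<And>k. f k \<le> f (k + 1)" shows "mono f"
proof (rule monoI)
  fix x y :: int assume "x \<le> y"
  then show "f x \<le> f y"
    by (induction y rule: int_ge_induct) (auto intro: order_trans assms)
qed

lemma int_const_stepI:
  fixes f :: "int \<Rightarrow> 'a"
  assumes "\<And>k. f (k + 1) = f k" shows "f k = f 0"
proof (induction k rule: int_induct[where k = 0])
  case (step2 i)
  then show ?case using assms[of "i - 1"] by simp
qed (simp_all add: assms)

lemma filterlim_int_shift:
  "filterlim (\<lambda>k::int. k - j) at_top at_top" "filterlim (\<lambda>k::int. k - j) at_bot at_bot"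
proof -
  show "filterlim (\<lambda>k::int. k - j) at_top at_top"
    unfolding filterlim_at_top
  proof
    fix Z :: int
    show "eventually (\<lambda>k. Z \<le> k - j) at_top"
      using eventually_ge_at_top[of "Z + j"] by (rule eventually_mono) simp
  qed
  show "filterlim (\<lambda>k::int. k - j) at_bot at_bot"
    unfolding filterlim_at_bot
  proof
    fix Z :: int
    show "eventually (\<lambda>k. k - j \<le> Z) at_bot"
      using eventually_le_at_bot[of "Z + j"] by (rule eventually_mono) simp
  qed
qed

lemma gcoef_shift: "n < 0 \<Longrightarrow> gcoef a (nat (- n)) = (\<lambda>k. a ((k - n) + n) (k - n))"
  by (auto simp: gcoef_def fun_eq_iff)

lemma fcoef_shift: "0 \<le> n \<Longrightarrow> fcoef a (nat n) = (\<lambda>k. a (k + n) k)"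
  by (auto simp: fcoef_def fun_eq_iff)

text \<open>The boundary map uses \<open>a (k + n) k\<close> for \<open>n \<ge> 0\<close> and \<open>a k (k - n)\<close> for \<open>n < 0\<close>. On a fixed
  diagonal the two parametrisations differ by a shift of \<open>k\<close>, so the limits agree.\<close>

lemma r_plus_eq:
  assumes "((\<lambda>k. a (k + n) k) \<longlongrightarrow> l) at_top" shows "r_plus a n = l"
proof (cases "0 \<le> n")
  case True
  then show ?thesis
    using assms by (simp add: r_plus_def fcoef_shift tendsto_Lim)
next
  case False
  then show ?thesis
    using filterlim_compose[OF assms filterlim_int_shift(1), of n]
    by (simp add: r_plus_def gcoef_shift tendsto_Lim)
qed

lemma r_minus_eq:
  assumes "((\<lambda>k. a (k + n) k) \<longlongrightarrow> l) at_bot" shows "r_minus a n = l"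
proof (cases "0 \<le> n")
  case True
  then show ?thesis
    using assms by (simp add: r_minus_def fcoef_shift tendsto_Lim)
next
  case False
  then show ?thesis
    using filterlim_compose[OF assms filterlim_int_shift(2), of n]
    by (simp add: r_minus_def gcoef_shift tendsto_Lim)
qed

lemma ell2_add: assumes "x \<in> ell2" "y \<in> ell2" shows "(\<lambda>k. x k + y k) \<in> ell2"
  unfolding ell2_def mem_Collect_eq
proof (rule summable_on_comparison_test)
  show "(\<lambda>k. 2 * (cmod (x k))\<^sup>2 + 2 * (cmod (y k))\<^sup>2) summable_on UNIV"
    using assms by (intro summable_on_add summable_on_cmult_right) (auto simp: ell2_def)
  fix k
  have "(cmod (x k + y k))\<^sup>2 \<le> (cmod (x k) + cmod (y k))\<^sup>2"
    by (intro power_mono norm_triangle_ineq) auto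
  also have "\<dots> \<le> 2 * (cmod (x k))\<^sup>2 + 2 * (cmod (y k))\<^sup>2"
    using sum_squares_bound[of "cmod (x k)" "cmod (y k)"] by (simp add: power2_sum)
  finally show "(cmod (x k + y k))\<^sup>2 \<le> 2 * (cmod (x k))\<^sup>2 + 2 * (cmod (y k))\<^sup>2" .
qed simp

lemma Dop_add: "Dop w (a + b) = Dop w a + Dop w b"
  by (intro ext) (simp add: Dop_entry algebra_simps add_divide_distrib diff_divide_distrib)

lemma Dop_mscale: "Dop w (mscale c a) = mscale c (Dop w a)"
  by (intro ext) (simp add: Dop_entry mscale_def algebra_simps diff_divide_distrib)

context weighted_hs begin

text \<open>The conditions defining the domain include square summability of the boundary values. It comes for
  free, since the bound on the entries of a diagonal passes to their limits.\<close>

lemma ell2_limits_of_dominated: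
  assumes y: "y \<in> HS w" and F: "F \<noteq> bot" and B: "0 \<le> B"
    and bound: "\<And>n k. cmod (a (k + n) k) \<le> B * diag_l1 y (n + q)"
    and lim: "\<And>n. ((\<lambda>k. a (k + n) k) \<longlongrightarrow> l n) F"
  shows "l \<in> ell2"
  unfolding ell2_def mem_Collect_eq
proof (rule summable_on_comparison_test)
  have bij: "bij_betw (\<lambda>m. m + q) UNIV UNIV"
    by (rule bij_betwI[where g = "\<lambda>m. m - q"]) auto
  show "(\<lambda>n. B\<^sup>2 * trS * diag_sq y (n + q)) summable_on UNIV"
    using diag_sq_summable[OF y] summable_on_reindex_bij_betw[OF bij, of "diag_sq y"]
    by (intro summable_on_cmult_right) simp
  fix n
  have "cmod (l n) \<le> B * diag_l1 y (n + q)"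
    using tendsto_norm[OF lim] by (rule tendsto_upperbound) (use bound F in auto)
  then have "(cmod (l n))\<^sup>2 \<le> (B * diag_l1 y (n + q))\<^sup>2"
    by (intro power_mono) auto
  also have "\<dots> \<le> B\<^sup>2 * (trS * diag_sq y (n + q))"
    using diag_l1_sq_le[OF y] by (simp add: power_mult_distrib mult_left_mono)
  finally show "(cmod (l n))\<^sup>2 \<le> B\<^sup>2 * trS * diag_sq y (n + q)"
    by (simp add: mult.assoc)
qed simp

lemma restr_dense:
  assumes a: "a \<in> HS w" and e: "0 < e"
  obtains F where "finite F" "hs_norm w (a - restr F a) < e"
proof -
  have "(\<lambda>x. norm ((wmod w a x)\<^sup>2)) summable_on UNIV"
    using a by (simp add: HS_iff)
  then obtain G where G: "finite G" "(\<Sum>\<^sub>\<infinity>x\<in>UNIV - G. norm ((wmod w a x)\<^sup>2)) < e\<^sup>2"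
    using infsum_abs_tail_small[of "\<lambda>x. (wmod w a x)\<^sup>2" UNIV "e\<^sup>2"] e by auto
  define F where "F = fst ` G \<union> snd ` G"
  have F: "finite F" "G \<subseteq> F \<times> F"
    using G(1) by (auto simp: F_def intro: rev_image_eqI)
  have sub: "(\<lambda>x. (wmod w a x)\<^sup>2) summable_on S" for S
    using a unfolding HS_iff by (rule summable_on_subset) auto
  have "(hs_norm w (a - restr F a))\<^sup>2 = (\<Sum>\<^sub>\<infinity>x\<in>UNIV - F \<times> F. (wmod w a x)\<^sup>2)"
    unfolding hs_norm_sq by (rule infsum_cong_neutral) (auto simp: wmod_restr_compl)
  also have "\<dots> \<le> (\<Sum>\<^sub>\<infinity>x\<in>UNIV - G. (wmod w a x)\<^sup>2)"
    using F(2) by (intro infsum_mono2 sub) auto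
  also have "\<dots> < e\<^sup>2" using G(2) by simp
  finally have "hs_norm w (a - restr F a) < e"
    using e by (meson less_imp_le power_less_imp_less_base)
  then show thesis using F(1) that by blast
qed

end

section \<open>Homogeneous solutions on the diagonals\<close>

locale cylinder =
  fixes w :: "int \<Rightarrow> real" and \<epsilon> c :: real and M N :: int
  assumes eps: "0 < \<epsilon>" and w_lower: "\<epsilon> \<le> w k" and w_upper: "w k \<le> c"
    and s_pos: "0 < sval w k"
begin

lemma w_pos: "0 < w k"
  using eps w_lower[of k] by linarith

lemma w_mono: "mono w"
proof (rule int_mono_stepI)
  fix k
  have "(w k)\<^sup>2 \<le> (w (k + 1))\<^sup>2"
    using s_pos[of "k + 1"] by (simp add: sval_def)
  then show "w k \<le> w (k + 1)"
    using less_imp_le[OF w_pos] by (rule power2_le_imp_le)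
qed

sublocale weighted_hs w
proof
  show "0 < sval w k" for k by (rule s_pos)
  \<comment> \<open>the trace of \<open>S\<close> telescopes\<close>
  have tele: "(\<Sum>k\<in>{- int n..int n}. sval w k) = (w (int n))\<^sup>2 - (w (- int n - 1))\<^sup>2" for n
  proof (induction n)
    case (Suc n)
    have "{- int (Suc n)..int (Suc n)} = insert (int n + 1) (insert (- int n - 1) {- int n..int n})"
      by auto
    with Suc show ?case by (simp add: sval_def algebra_simps)
  qed (simp add: sval_def)
  show "sval w summable_on UNIV"
  proof (rule finite_sums_le_imp_summable_on(1))
    fix F :: "int set" assume F: "finite F"
    define n where "n = (\<Sum>k\<in>F. nat \<bar>k\<bar>)"
    have "nat \<bar>k\<bar> \<le> n" if "k \<in> F" for k
      unfolding n_def using F that by (intro member_le_sum) auto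
    then have "F \<subseteq> {- int n..int n}" by force
    then have "sum (sval w) F \<le> (\<Sum>k\<in>{- int n..int n}. sval w k)"
      using less_imp_le[OF s_pos] by (intro sum_mono2) auto
    also have "\<dots> \<le> c\<^sup>2"
      unfolding tele using power_mono[OF w_upper less_imp_le[OF w_pos], of "int n" 2]
        zero_le_power2[of "w (- int n - 1)"] by linarith
    finally show "sum (sval w) F \<le> c\<^sup>2" .
  qed (use less_imp_le[OF s_pos] in auto)
qed

text \<open>A two-sided product of weights, normalised to \<open>1\<close> at \<open>0\<close> and characterised by \<open>cumprod_step\<close>.\<close>

definition cumprod :: "int \<Rightarrow> real" where
  "cumprod k = (if 0 \<le> k then \<Prod>i\<in>{0..<k}. w i else 1 / (\<Prod>i\<in>{k..<0}. w i))"

lemma cumprod_pos: "0 < cumprod k"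
  by (simp add: cumprod_def prod_pos w_pos)

lemma cumprod_step: "cumprod (k + 1) = w k * cumprod k"
proof (cases "0 \<le> k")
  case True
  then have "{0..<k + 1} = insert k {0..<k}" by auto
  with True show ?thesis by (simp add: cumprod_def)
next
  case False
  then have "{k..<0} = insert k {k + 1..<0}" by auto
  with False show ?thesis
    using w_pos[of k] by (auto simp: cumprod_def)
qed

text \<open>The solution of \<open>w k * x (k + 1) = w (k + n) * x k\<close> on the diagonal \<open>n\<close>. It equals
  \<open>w k * \<dots> * w (k + n - 1)\<close> for \<open>n \<ge> 0\<close> and \<open>1 / (w (k + n) * \<dots> * w (k - 1))\<close> for \<open>n < 0\<close>; the
  quotient covers both cases at once.\<close>

definition h :: "int \<Rightarrow> int \<Rightarrow> real" where
  "h n k = cumprod (k + n) / cumprod k"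

lemma h_pos: "0 < h n k"
  by (simp add: h_def cumprod_pos)

lemma h_0: "h 0 k = 1"
  using cumprod_pos[of k] by (simp add: h_def)

lemma h_up: "h (n + 1) k = w (k + n) * h n k"
  using cumprod_step[of "k + n"] by (simp add: h_def add.assoc)

lemma h_right: "w k * h n (k + 1) = h (n + 1) k"
  using cumprod_step[of k] w_pos[of k] cumprod_pos[of k] by (simp add: h_def algebra_simps)

lemma h_step: "w k * h n (k + 1) = w (k + n) * h n k"
  by (simp only: h_right h_up)

lemma h_mono: assumes "0 \<le> n" shows "mono (h n)"
proof (rule int_mono_stepI)
  fix k
  have "w k * h n k \<le> w (k + n) * h n k"
    using assms monoD[OF w_mono, of k "k + n"] less_imp_le[OF h_pos] by (intro mult_right_mono) auto
  then show "h n k \<le> h n (k + 1)"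
    using w_pos[of k] by (simp flip: h_step)
qed

lemma h_antimono: assumes "n \<le> 0" "k \<le> l" shows "h n l \<le> h n k"
proof -
  have "mono (\<lambda>k. - h n k)"
  proof (rule int_mono_stepI)
    fix k
    have "w (k + n) * h n k \<le> w k * h n k"
      using assms monoD[OF w_mono, of "k + n" k] less_imp_le[OF h_pos] by (intro mult_right_mono) auto
    then show "- h n k \<le> - h n (k + 1)"
      using w_pos[of k] by (simp flip: h_step)
  qed
  from monoD[OF this assms(2)] show ?thesis by simp
qed

text \<open>By induction on \<open>n\<close> in both directions, each step multiplying or dividing by a weight between \<open>\<epsilon>\<close>
  and \<open>c\<close>. The bounds depend on \<open>n\<close>.\<close>

lemma h_bounds: "\<exists>b C. 0 < b \<and> (\<forall>k. b \<le> h n k \<and> h n k \<le> C)"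
proof (induction n rule: int_induct[where k = 0])
  case base
  show ?case by (intro exI[of _ 1]) (simp add: h_0)
next
  case (step1 n)
  then obtain b C where b: "0 < b" "\<And>k. b \<le> h n k" "\<And>k. h n k \<le> C" by blast
  have "\<epsilon> * b \<le> h (n + 1) k \<and> h (n + 1) k \<le> c * C" for k
    unfolding h_up using b eps w_lower w_upper w_pos[of "k + n"] order_trans[OF w_lower w_upper] h_pos[of n k]
    by (intro conjI mult_mono) (auto intro: less_imp_le)
  then show ?case using b(1) eps by (intro exI[of _ "\<epsilon> * b"] exI[of _ "c * C"]) auto
next
  case (step2 n)
  then obtain b C where b: "0 < b" "\<And>k. b \<le> h n k" "\<And>k. h n k \<le> C" by blast
  have eq: "h (n - 1) k = h n k / w (k + n - 1)" for k
    using h_up[of "n - 1" k] w_pos[of "k + n - 1"] by (simp add: algebra_simps)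
  have c: "0 < c" using eps order_trans[OF w_lower w_upper] by linarith
  have "b / c \<le> h (n - 1) k \<and> h (n - 1) k \<le> C / \<epsilon>" for k
    unfolding eq using b eps w_lower w_upper w_pos[of "k + n - 1"] h_pos[of n k] c
      order_trans[OF less_imp_le[OF h_pos] b(3)]
    by (intro conjI frac_le) (auto intro: less_imp_le)
  then show ?case using b(1) c by (intro exI[of _ "b / c"] exI[of _ "C / \<epsilon>"]) auto
qed

lemma w_limits:
  "\<exists>l1>0. \<exists>l2>0. ((\<lambda>k. w (k + n)) \<longlongrightarrow> l1) at_top \<and> ((\<lambda>k. w (k + n)) \<longlongrightarrow> l2) at_bot"
proof -
  have "mono (\<lambda>k. w (k + n))"
    using w_mono by (auto simp: mono_def)
  then obtain l1 l2 where l: "((\<lambda>k. w (k + n)) \<longlongrightarrow> l1) at_top" "((\<lambda>k. w (k + n)) \<longlongrightarrow> l2) at_bot"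
    using mono_int_has_limits[of "\<lambda>k. w (k + n)" c \<epsilon>] w_upper w_lower by auto
  have "\<epsilon> \<le> l1" "\<epsilon> \<le> l2"
    by (rule tendsto_lowerbound[OF l(1)]; simp add: w_lower)
       (rule tendsto_lowerbound[OF l(2)]; simp add: w_lower)
  then have "0 < l1" "0 < l2" using eps by linarith+
  with l show ?thesis by blast
qed

lemma h_limits:
  "\<exists>l1>0. \<exists>l2>0. (h n \<longlongrightarrow> l1) at_top \<and> (h n \<longlongrightarrow> l2) at_bot"
proof (induction n rule: int_induct[where k = 0])
  case base
  have "h 0 = (\<lambda>_. 1)" by (simp add: h_0 fun_eq_iff)
  then show ?case by (intro exI[of _ 1] conjI) auto
next
  case (step1 n)
  then obtain l1 l2 where l: "l1 > 0" "l2 > 0" "(h n \<longlongrightarrow> l1) at_top" "(h n \<longlongrightarrow> l2) at_bot" by blast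
  obtain v1 v2 where v: "v1 > 0" "v2 > 0" "((\<lambda>k. w (k + n)) \<longlongrightarrow> v1) at_top" "((\<lambda>k. w (k + n)) \<longlongrightarrow> v2) at_bot"
    using w_limits by blast
  have eq: "h (n + 1) = (\<lambda>k. w (k + n) * h n k)" by (simp add: h_up fun_eq_iff)
  show ?case
    unfolding eq using tendsto_mult[OF v(3) l(3)] tendsto_mult[OF v(4) l(4)] l(1,2) v(1,2)
    by (intro exI[of _ "v1 * l1"] exI[of _ "v2 * l2"] conjI) auto
next
  case (step2 n)
  then obtain l1 l2 where l: "l1 > 0" "l2 > 0" "(h n \<longlongrightarrow> l1) at_top" "(h n \<longlongrightarrow> l2) at_bot" by blast
  obtain v1 v2 where v: "v1 > 0" "v2 > 0" "((\<lambda>k. w (k + (n - 1))) \<longlongrightarrow> v1) at_top" "((\<lambda>k. w (k + (n - 1))) \<longlongrightarrow> v2) at_bot"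
    using w_limits by blast
  have eq: "h (n - 1) = (\<lambda>k. h n k / w (k + (n - 1)))"
  proof
    fix k
    show "h (n - 1) k = h n k / w (k + (n - 1))"
      using h_up[of "n - 1" k] w_pos[of "k + (n - 1)"] by simp
  qed
  show ?case
    unfolding eq using tendsto_divide[OF l(3) v(3)] tendsto_divide[OF l(4) v(4)] l(1,2) v(1,2)
    by (intro exI[of _ "l1 / v1"] exI[of _ "l2 / v2"] conjI) auto
qed

definition hplus :: "int \<Rightarrow> real" where "hplus n = Lim at_top (h n)"
definition hminus :: "int \<Rightarrow> real" where "hminus n = Lim at_bot (h n)"

lemma h_lims:
  "0 < hplus n" "0 < hminus n" "(h n \<longlongrightarrow> hplus n) at_top" "(h n \<longlongrightarrow> hminus n) at_bot"
proof -
  obtain l1 l2 where l: "l1 > 0" "l2 > 0" "(h n \<longlongrightarrow> l1) at_top" "(h n \<longlongrightarrow> l2) at_bot"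
    using h_limits by blast
  have "hplus n = l1" "hminus n = l2"
    unfolding hplus_def hminus_def using l(3,4) by (auto intro!: tendsto_Lim)
  then show "0 < hplus n" "0 < hminus n" "(h n \<longlongrightarrow> hplus n) at_top" "(h n \<longlongrightarrow> hminus n) at_bot"
    using l by auto
qed

section \<open>The Green operator\<close>

text \<open>Variation of constants: if \<open>x = h n * \<zeta>\<close> on the diagonal \<open>n\<close> and \<open>D a = y\<close>, then
  \<open>\<zeta> (k + 1) - \<zeta> k = incr y n k\<close>.\<close>

definition incr :: "mat \<Rightarrow> int \<Rightarrow> int \<Rightarrow> complex" where
  "incr y n i = of_real (wt w (i + (n + 1)) i * (1 / h (n + 1) i)) * y (i + (n + 1)) i"

text \<open>The direction of summation is the one that meets the boundary condition: for \<open>n > N\<close> the solution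
  has to vanish at \<open>+\<infinity>\<close>. For \<open>n \<le> N\<close> the only possible condition is the one at \<open>-\<infinity>\<close>.\<close>

definition quot :: "mat \<Rightarrow> int \<Rightarrow> int \<Rightarrow> complex" where
  "quot y n k = (if N < n then - infsum (incr y n) {k..} else infsum (incr y n) {..<k})"

definition green :: "mat \<Rightarrow> mat" where
  "green y = (\<lambda>i j. of_real (h (i - j) j) * quot y (i - j) j)"

lemma green_diag: "green y (k + n) k = of_real (h n k) * quot y n k"
  by (simp add: green_def)

lemma incr_abs_summable: assumes y: "y \<in> HS w" shows "(\<lambda>i. norm (incr y n i)) summable_on S"
proof -
  obtain b where b: "0 < b" "\<And>k. b \<le> h (n + 1) k" using h_bounds by blast
  have "(\<lambda>i. norm (incr y n i)) summable_on UNIV"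
  proof (rule summable_on_comparison_test)
    show "(\<lambda>i. 1 / b * (wt w (i + (n + 1)) i * cmod (y (i + (n + 1)) i))) summable_on UNIV"
      by (intro summable_on_cmult_right diag_l1_summable y)
    fix i
    have "norm (incr y n i) = 1 / h (n + 1) i * (wt w (i + (n + 1)) i * cmod (y (i + (n + 1)) i))"
      using h_pos[of "n + 1" i] wt_pos[of "i + (n + 1)" i] by (simp add: incr_def norm_mult norm_divide)
    also have "\<dots> \<le> 1 / b * (wt w (i + (n + 1)) i * cmod (y (i + (n + 1)) i))"
      using b less_imp_le[OF wt_pos] by (intro mult_right_mono frac_le) auto
    finally show "norm (incr y n i) \<le> 1 / b * (wt w (i + (n + 1)) i * cmod (y (i + (n + 1)) i))" .
  qed auto
  then show ?thesis by (rule summable_on_subset) auto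
qed

lemma incr_summable: "y \<in> HS w \<Longrightarrow> incr y n summable_on S"
  by (rule abs_summable_summable[OF incr_abs_summable])

lemma quot_step: assumes y: "y \<in> HS w" shows "quot y n (k + 1) = quot y n k + incr y n k"
proof -
  have "{k..} = insert k {k + 1..}" "{..<k + 1} = insert k {..<k}" by auto
  then show ?thesis
    by (simp add: quot_def infsum_insert incr_summable[OF y])
qed

lemma Dop_diag:
  assumes a: "\<And>n k. a (k + n) k = of_real (h n k) * \<zeta> n k"
  shows "Dop w a (k + m) k = of_real (h m k / wt w (k + m) k) * (\<zeta> (m - 1) (k + 1) - \<zeta> (m - 1) k)"
proof -
  have 1: "a (k + m) (k + 1) * of_real (w k) = of_real (h m k) * \<zeta> (m - 1) (k + 1)"
    using a[of "k + 1" "m - 1"] h_right[of k "m - 1"] by (simp add: mult_ac flip: of_real_mult)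
  have 2: "of_real (w (k + m - 1)) * a (k + m - 1) k = of_real (h m k) * \<zeta> (m - 1) k"
    using a[of k "m - 1"] h_up[of "m - 1" k] by (simp add: algebra_simps flip: of_real_mult)
  show ?thesis
    unfolding Dop_entry 1 2 by (simp add: wt_def right_diff_distrib diff_divide_distrib)
qed

lemma Dop_green: assumes y: "y \<in> HS w" shows "Dop w (green y) = y"
  unfolding mat_eq_by_diagonals
proof (intro allI)
  fix m k
  have "Dop w (green y) (k + m) k = of_real (h m k / wt w (k + m) k) * incr y (m - 1) k"
    by (simp add: Dop_diag[OF green_diag] quot_step[OF y])
  also have "\<dots> = y (k + m) k"
    using h_pos[of m k] wt_pos[of "k + m" k] by (simp add: incr_def)
  finally show "Dop w (green y) (k + m) k = y (k + m) k" .
qed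

text \<open>For \<open>n \<ge> 0\<close> and \<open>n > N\<close> the sum runs over \<open>i \<ge> k\<close>, where \<open>h n k \<le> h n i = h (n + 1) i / w (i + n)\<close>.
  For \<open>n < 0\<close> and \<open>n \<le> N\<close> it runs over \<open>i < k\<close>, where
  \<open>h n k \<le> h n (i + 1) = h (n + 1) i / w i\<close>. Both cases give the constant \<open>1 / \<epsilon>\<close>, and the finitely
  many \<open>n\<close> between \<open>0\<close> and \<open>N\<close> that remain have constants of their own.\<close>

lemma h_ratio_bound:
  "\<exists>B\<ge>0. \<forall>n k i. (if N < n then k \<le> i else i < k) \<longrightarrow> h n k \<le> B * h (n + 1) i"
proof -
  have "\<exists>B\<ge>0. \<forall>k i. h n k \<le> B * h (n + 1) i" for n
  proof -
    obtain b where b: "0 < b" "\<And>k. b \<le> h (n + 1) k" using h_bounds by blast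
    obtain C where C: "\<And>k. h n k \<le> C" using h_bounds by blast
    have C0: "0 \<le> C" using less_imp_le[OF h_pos] C by (rule order_trans)
    have "h n k \<le> C / b * h (n + 1) i" for k i
    proof -
      have "h n k \<le> C / b * b" using C b(1) by simp
      also have "\<dots> \<le> C / b * h (n + 1) i" using b C0 by (intro mult_left_mono) auto
      finally show ?thesis .
    qed
    then show ?thesis using b(1) C0 by (intro exI[of _ "C / b"]) auto
  qed
  then obtain B where B: "\<And>n. 0 \<le> B n" "\<And>n k i. h n k \<le> B n * h (n + 1) i" by metis
  let ?E = "{N<..<0} \<union> {0..N}"
  define D where "D = 1 / \<epsilon> + sum B ?E"
  have D0: "0 \<le> 1 / \<epsilon>" "0 \<le> sum B ?E" using eps B(1) by (auto intro: sum_nonneg)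
  have "h n k \<le> D * h (n + 1) i" if i: "if N < n then k \<le> i else i < k" for n k i
  proof (cases "n \<in> ?E")
    case True
    then have "B n \<le> D"
      using member_le_sum[of n ?E B] B(1) D0(1) by (auto simp: D_def intro: add_increasing)
    then have "B n * h (n + 1) i \<le> D * h (n + 1) i"
      using less_imp_le[OF h_pos] by (intro mult_right_mono)
    with B(2)[of n k i] show ?thesis by linarith
  next
    case False
    have "\<epsilon> * h n k \<le> h (n + 1) i"
    proof (cases "N < n")
      case True
      with False have "0 \<le> n" by auto
      then have "\<epsilon> * h n k \<le> w (i + n) * h n i"
        using monoD[OF h_mono, of n k i] i True w_lower eps less_imp_le[OF h_pos] less_imp_le[OF w_pos]
        by (intro mult_mono) auto
      then show ?thesis by (simp only: h_up)
    next
      case False': False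
      with False have "n \<le> 0" by auto
      then have "\<epsilon> * h n k \<le> w i * h n (i + 1)"
        using h_antimono[of n "i + 1" k] i False' w_lower eps less_imp_le[OF h_pos] less_imp_le[OF w_pos]
        by (intro mult_mono) auto
      then show ?thesis by (simp only: h_right)
    qed
    then have "h n k \<le> 1 / \<epsilon> * h (n + 1) i"
      using eps by (simp add: field_simps)
    also have "\<dots> \<le> D * h (n + 1) i"
      using D0 less_imp_le[OF h_pos] by (intro mult_right_mono) (auto simp: D_def)
    finally show ?thesis .
  qed
  moreover have "0 \<le> D" using D0 by (simp add: D_def)
  ultimately show ?thesis by blast
qed

lemma green_bound: "\<exists>B\<ge>0. \<forall>y\<in>HS w. \<forall>n k. cmod (green y (k + n) k) \<le> B * diag_l1 y (n + 1)"
proof -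
  obtain B where B: "0 \<le> B" "\<And>n k i. (if N < n then k \<le> i else i < k) \<Longrightarrow> h n k \<le> B * h (n + 1) i"
    using h_ratio_bound by blast
  have "cmod (green y (k + n) k) \<le> B * diag_l1 y (n + 1)" if y: "y \<in> HS w" for y n k
  proof -
    define S where "S = (if N < n then {k..} else {..<k})"
    let ?f = "\<lambda>i. wt w (i + (n + 1)) i * cmod (y (i + (n + 1)) i)"
    have le: "h n k * norm (incr y n i) \<le> B * ?f i" if "i \<in> S" for i
    proof -
      have r: "h n k * (1 / h (n + 1) i) \<le> B"
        using B(2)[of n k i] that h_pos[of "n + 1" i] by (simp add: S_def field_simps split: if_splits)
      have "h n k * norm (incr y n i) = h n k * (1 / h (n + 1) i) * ?f i"
        using h_pos[of "n + 1" i] wt_pos[of "i + (n + 1)" i] by (simp add: incr_def norm_mult norm_divide)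
      also have "\<dots> \<le> B * ?f i"
        using r less_imp_le[OF wt_pos] by (intro mult_right_mono) auto
      finally show ?thesis .
    qed
    have fs: "?f summable_on S" for S
      using diag_l1_summable[OF y] by (rule summable_on_subset) auto
    have "cmod (green y (k + n) k) = h n k * norm (infsum (incr y n) S)"
      using h_pos[of n k] by (simp add: green_diag quot_def S_def norm_mult)
    also have "\<dots> \<le> h n k * (\<Sum>\<^sub>\<infinity>i\<in>S. norm (incr y n i))"
      using less_imp_le[OF h_pos] by (intro mult_left_mono norm_infsum_bound incr_abs_summable y)
    also have "\<dots> = (\<Sum>\<^sub>\<infinity>i\<in>S. h n k * norm (incr y n i))"
      by (simp add: infsum_cmult_right')
    also have "\<dots> \<le> (\<Sum>\<^sub>\<infinity>i\<in>S. B * ?f i)"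
      using le by (intro infsum_mono summable_on_cmult_right incr_abs_summable y fs)
    also have "\<dots> = B * infsum ?f S"
      by (simp add: infsum_cmult_right')
    also have "\<dots> \<le> B * diag_l1 y (n + 1)"
      unfolding diag_l1_def using B(1) less_imp_le[OF wt_pos]
      by (intro mult_left_mono infsum_mono2 fs) auto
    finally show ?thesis .
  qed
  with B(1) show ?thesis by blast
qed

lemma green_dominated: "dominated 1 green"
  unfolding dominated_def
proof (intro conjI ballI allI)
  fix y y' assume y: "y \<in> HS w" "y' \<in> HS w"
  have "incr (y + y') n = (\<lambda>i. incr y n i + incr y' n i)" for n
    by (simp add: incr_def fun_eq_iff algebra_simps add_divide_distrib)
  then have "quot (y + y') n k = quot y n k + quot y' n k" for n k
    using y by (simp add: quot_def infsum_add incr_summable)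
  then show "green (y + y') = green y + green y'"
    by (simp add: green_def fun_eq_iff algebra_simps)
next
  fix a y assume "y \<in> HS w"
  have "incr (mscale a y) n = (\<lambda>i. a * incr y n i)" for n
    by (simp add: incr_def mscale_def fun_eq_iff)
  then have "quot (mscale a y) n k = a * quot y n k" for n k
    by (simp add: quot_def infsum_cmult_right')
  then show "green (mscale a y) = mscale a (green y)"
    by (simp add: green_def mscale_def fun_eq_iff)
next
  show "\<exists>B\<ge>0. \<forall>y\<in>HS w. \<forall>m k. cmod (green y (k + m) k) \<le> B * diag_l1 y (m + 1)"
    by (rule green_bound)
qed

text \<open>The difference of the limits of \<open>\<zeta>\<close> at the two ends, for every solution on the diagonal \<open>n\<close>.\<close>

abbreviation "flux y n \<equiv> infsum (incr y n) UNIV"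

lemma quot_limits:
  assumes y: "y \<in> HS w"
  shows "(quot y n \<longlongrightarrow> (if N < n then 0 else flux y n)) at_top"
    and "(quot y n \<longlongrightarrow> (if N < n then - flux y n else 0)) at_bot"
proof -
  have split: "flux y n = infsum (incr y n) {..<k} + infsum (incr y n) {k..}" for k
    by (subst infsum_Un_disjoint[symmetric])
       (auto intro!: incr_summable y arg_cong[where f = "infsum _"])
  have top: "((\<lambda>k. infsum (incr y n) {k..}) \<longlongrightarrow> 0) at_top"
  proof (rule tendsto_infsum_escaping[OF incr_abs_summable[OF y]])
    show "eventually (\<lambda>k. i \<notin> {k..}) at_top" for i :: int
      using eventually_gt_at_top[of i] by (rule eventually_mono) auto
  qed
  have bot: "((\<lambda>k. infsum (incr y n) {..<k}) \<longlongrightarrow> 0) at_bot"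
  proof (rule tendsto_infsum_escaping[OF incr_abs_summable[OF y]])
    show "eventually (\<lambda>k. i \<notin> {..<k}) at_bot" for i :: int
      using eventually_le_at_bot[of i] by (rule eventually_mono) auto
  qed
  have z: "quot y n = (if N < n then (\<lambda>k. - infsum (incr y n) {k..}) else (\<lambda>k. flux y n - infsum (incr y n) {k..}))"
    "quot y n = (if N < n then (\<lambda>k. infsum (incr y n) {..<k} - flux y n) else (\<lambda>k. infsum (incr y n) {..<k}))"
    using split by (auto simp: quot_def fun_eq_iff algebra_simps)
  show "(quot y n \<longlongrightarrow> (if N < n then 0 else flux y n)) at_top"
    unfolding z(1) using tendsto_minus[OF top] tendsto_diff[OF tendsto_const[of "flux y n"] top] by simp
  show "(quot y n \<longlongrightarrow> (if N < n then - flux y n else 0)) at_bot"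
    unfolding z(2) using bot tendsto_diff[OF bot tendsto_const[of "flux y n"]] by simp
qed

lemma green_limits:
  assumes y: "y \<in> HS w"
  shows "((\<lambda>k. green y (k + n) k) \<longlongrightarrow> of_real (hplus n) * (if N < n then 0 else flux y n)) at_top"
    and "((\<lambda>k. green y (k + n) k) \<longlongrightarrow> of_real (hminus n) * (if N < n then - flux y n else 0)) at_bot"
  unfolding green_diag by (intro tendsto_mult tendsto_of_real h_lims quot_limits y)+

section \<open>The domain of the d-bar operator\<close>

text \<open>The kernel lives on the diagonals without boundary condition and the cokernel on the images, under
  \<open>n \<mapsto> n + 1\<close>, of the diagonals with two conditions.\<close>

sublocale K: diag_family w "{- M..N}" h
proof
  show "\<exists>b. \<forall>k. h m k \<le> b" for m
    using h_bounds[of m] by blast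
qed (simp_all add: h_pos)

sublocale C: diag_family w "{N + 2..- M}" "\<lambda>n k. 1 / h n k"
proof
  show "\<exists>b. \<forall>k. 1 / h m k \<le> b" for m
  proof -
    obtain b where b: "0 < b" "\<And>k. b \<le> h m k" using h_bounds by blast
    then have "1 / h m k \<le> 1 / b" for k
      by (intro frac_le) auto
    then show ?thesis by blast
  qed
qed (simp_all add: h_pos)

lemma Dop_K: assumes "v \<in> K.V" shows "Dop w v = 0"
proof -
  obtain d where d: "\<And>m k. v (k + m) k = (if m \<in> {- M..N} then d m * of_real (h m k) else 0)"
    using assms unfolding K.V_iff by blast
  have "v (k + m) k = of_real (h m k) * (if m \<in> {- M..N} then d m else 0)" for m k
    using d by simp
  from Dop_diag[OF this] show ?thesis
    unfolding mat_eq_by_diagonals by simp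
qed

sublocale parametrix w "{- M..N}" h "{N + 2..- M}" "\<lambda>n k. 1 / h n k" "Dop w" green 1
  by unfold_locales (simp_all only: Dop_add Dop_mscale green_dominated Dop_green Dop_K)

lemma C_proj_eq_zero_iff: "C.proj y = 0 \<longleftrightarrow> (\<forall>n. N < n \<and> n < - M \<longrightarrow> flux y n = 0)"
proof -
  have "hs_inner w (diag_vec (\<lambda>n k. 1 / h n k) m) y = flux y (m - 1)" for m
    unfolding C.inner_dv by (intro infsum_cong) (simp add: incr_def)
  then have "C.proj y = 0 \<longleftrightarrow> (\<forall>m\<in>{N + 2..- M}. flux y (m - 1) = 0)"
    by (simp add: C.proj_eq_zero_iff)
  also have "\<dots> \<longleftrightarrow> (\<forall>n. N < n \<and> n < - M \<longrightarrow> flux y n = 0)"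
  proof (intro iffI allI ballI impI)
    fix n assume "\<forall>m\<in>{N + 2..- M}. flux y (m - 1) = 0" "N < n \<and> n < - M"
    then show "flux y n = 0"
      by (drule_tac bspec[where x = "n + 1"]) auto
  qed auto
  finally show ?thesis .
qed

text \<open>The boundary values of \<open>green y + v\<close> are explicit. Those required to vanish do so: by the choice of
  the direction of summation, by the support of \<open>v\<close>, and for \<open>N < n < -M\<close> at \<open>-\<infinity>\<close> because the
  flux is zero.\<close>

lemma domT_subset_dom: "domT \<subseteq> dom_DMN w M N"
proof
  fix a assume a: "a \<in> domT"
  let ?y = "Dop w a"
  obtain v where v: "v \<in> K.V" "a = green ?y + v" and y: "?y \<in> HS w" "C.proj ?y = 0"
    using a by (rule domT_cases)
  obtain d where d: "\<And>m k. v (k + m) k = (if m \<in> {- M..N} then d m * of_real (h m k) else 0)"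
    using v(1) unfolding K.V_iff by blast
  define vp where "vp n = (if n \<in> {- M..N} then d n * of_real (hplus n) else 0)" for n
  define vm where "vm n = (if n \<in> {- M..N} then d n * of_real (hminus n) else 0)" for n
  have vlim: "((\<lambda>k. v (k + n) k) \<longlongrightarrow> vp n) at_top" "((\<lambda>k. v (k + n) k) \<longlongrightarrow> vm n) at_bot" for n
    unfolding d vp_def vm_def using h_lims(3,4)[of n] by (auto intro!: tendsto_intros)
  have vH: "v \<in> HS w" using v(1) K.V_HS by blast
  obtain Bv where Bv: "0 \<le> Bv" "\<And>n k. cmod (v (k + n) k) \<le> Bv * diag_l1 v (n + 0)"
    using K.dominated_proj vH K.proj_V[OF v(1)] unfolding dominated_def by metis
  obtain B where B: "0 \<le> B" "\<And>n k. cmod (green ?y (k + n) k) \<le> B * diag_l1 ?y (n + 1)"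
    using green_bound y(1) by blast
  note Rl = green_limits[OF y(1)]
  define rp where "rp n = of_real (hplus n) * (if N < n then 0 else flux ?y n)" for n
  define rm where "rm n = of_real (hminus n) * (if N < n then - flux ?y n else 0)" for n
  have entry: "a (k + n) k = green ?y (k + n) k + v (k + n) k" for n k
    by (subst v(2)) simp
  have rplus: "r_plus a = (\<lambda>n. rp n + vp n)"
    by (rule ext, rule r_plus_eq) (unfold entry rp_def, intro tendsto_add Rl vlim)
  have rminus: "r_minus a = (\<lambda>n. rm n + vm n)"
    by (rule ext, rule r_minus_eq) (unfold entry rm_def, intro tendsto_add Rl vlim)
  have "rp \<in> ell2"
    using ell2_limits_of_dominated[OF y(1) _ B, of at_top rp] Rl(1) by (simp add: rp_def)
  moreover have "rm \<in> ell2"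
    using ell2_limits_of_dominated[OF y(1) _ B, of at_bot rm] Rl(2) by (simp add: rm_def)
  moreover have "vp \<in> ell2"
    using ell2_limits_of_dominated[OF vH _ Bv, of at_top vp] vlim(1) by simp
  moreover have "vm \<in> ell2"
    using ell2_limits_of_dominated[OF vH _ Bv, of at_bot vm] vlim(2) by simp
  ultimately have "r_plus a \<in> ell2" "r_minus a \<in> ell2"
    unfolding rplus rminus by (auto intro: ell2_add)
  moreover have "r_plus a n = 0" if "N < n" for n
    using that by (simp add: rplus rp_def vp_def)
  moreover have "r_minus a n = 0" if "n < - M" for n
    using that y(2) unfolding C_proj_eq_zero_iff by (auto simp: rminus rm_def vm_def)
  moreover have "a \<in> DomD w"
    using a y(1) domT_subset by (auto simp: DomD_def)
  ultimately show "a \<in> dom_DMN w M N"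
    by (auto simp: dom_DMN_def RanP_plus_def RanP_minus_def)
qed

lemma Dop_eq_zero_imp:
  assumes "Dop w b = 0"
  shows "\<exists>d. \<forall>n k. b (k + n) k = d n * of_real (h n k)"
proof -
  define \<zeta> where "\<zeta> n k = b (k + n) k / of_real (h n k)" for n k
  have b: "b (k + n) k = of_real (h n k) * \<zeta> n k" for n k
    using h_pos[of n k] by (simp add: \<zeta>_def)
  have "\<zeta> n (k + 1) = \<zeta> n k" for n k
    using Dop_diag[OF b, of k "n + 1"] assms h_pos[of "n + 1" k] wt_pos[of "k + (n + 1)" k] by simp
  then have "\<zeta> n k = \<zeta> n 0" for n k
    by (rule int_const_stepI)
  then have "b (k + n) k = \<zeta> n 0 * of_real (h n k)" for n k
    using b[of k n] by (simp add: mult.commute)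
  then show ?thesis by (intro exI[of _ "\<lambda>n. \<zeta> n 0"] allI)
qed

text \<open>Any \<open>a\<close> in \<open>dom_DMN w M N\<close> is \<open>green (D a)\<close> plus \<open>d n * h n\<close> on each diagonal, so its boundary
  limits exist and are explicit. The boundary conditions then force \<open>d n = 0\<close> outside
  \<open>-M \<le> n \<le> N\<close>, and zero flux of \<open>D a\<close> on the diagonals with two conditions.\<close>

lemma dom_subset_domT: "dom_DMN w M N \<subseteq> domT"
proof
  fix a assume a: "a \<in> dom_DMN w M N"
  let ?y = "Dop w a"
  have y: "?y \<in> HS w" and aH: "a \<in> HS w"
    using a by (auto simp: dom_DMN_def DomD_def)
  have rp0: "r_plus a n = 0" if "N < n" for n
    using a that by (auto simp: dom_DMN_def RanP_plus_def)
  have rm0: "r_minus a n = 0" if "n < - M" for n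
    using a that by (auto simp: dom_DMN_def RanP_minus_def)
  have "Dop w ((a - green ?y) + green ?y) = Dop w (a - green ?y) + Dop w (green ?y)"
    by (rule Dop_add)
  then have "Dop w (a - green ?y) = 0"
    using Dop_green[OF y] by simp
  then obtain d where d: "\<And>n k. (a - green ?y) (k + n) k = d n * of_real (h n k)"
    using Dop_eq_zero_imp by blast
  have entry: "a (k + n) k = green ?y (k + n) k + d n * of_real (h n k)" for n k
    using d[of k n] by (simp add: algebra_simps)
  have rp: "r_plus a n = of_real (hplus n) * (if N < n then 0 else flux ?y n) + d n * of_real (hplus n)" for n
    by (rule r_plus_eq) (unfold entry, intro tendsto_intros green_limits[OF y] h_lims)
  have rm: "r_minus a n = of_real (hminus n) * (if N < n then - flux ?y n else 0) + d n * of_real (hminus n)" for n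
    by (rule r_minus_eq) (unfold entry, intro tendsto_intros green_limits[OF y] h_lims)
  have d1: "d n = 0" if "N < n" for n
    using rp[of n] rp0[OF that] that h_lims(1)[of n] by simp
  have flux0: "flux ?y n = 0" if "N < n" "n < - M" for n
    using rm[of n] rm0[OF that(2)] that(1) d1[OF that(1)] h_lims(2)[of n] by simp
  have d2: "d n = 0" if "n < - M" for n
    using rm[of n] rm0[OF that] d1[of n] h_lims(2)[of n] by (cases "N < n") auto
  have "a - green ?y \<in> K.V"
    unfolding K.V_iff by (rule exI[of _ d]) (use d d1 d2 in \<open>force simp: not_le\<close>)
  moreover have "C.proj ?y = 0"
    unfolding C_proj_eq_zero_iff using flux0 by blast
  ultimately show "a \<in> domT"
    using y aH by (simp add: domT_def)
qed

lemma dom_eq_domT: "dom_DMN w M N = domT"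
  using domT_subset_dom dom_subset_domT by blast

lemma restr_in_dom:
  assumes F: "finite F" shows "restr F a \<in> dom_DMN w M N"
proof -
  let ?a = "restr F a"
  have "Dop w ?a \<in> HS w"
  proof -
    have "{x. (wmod w (Dop w ?a) x)\<^sup>2 \<noteq> 0} \<subseteq> (\<lambda>(i, j). (i, j - 1)) ` (F \<times> F) \<union> (\<lambda>(i, j). (i + 1, j)) ` (F \<times> F)"
    proof
      fix x assume "x \<in> {x. (wmod w (Dop w ?a) x)\<^sup>2 \<noteq> 0}"
      moreover obtain i j where x: "x = (i, j)" by fastforce
      ultimately have "Dop w ?a i j \<noteq> 0" by (auto simp: wmod_def)
      then have "(i, j + 1) \<in> F \<times> F \<or> (i - 1, j) \<in> F \<times> F"
        by (auto simp: Dop_entry restr_def split: if_splits)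
      then show "x \<in> (\<lambda>(i, j). (i, j - 1)) ` (F \<times> F) \<union> (\<lambda>(i, j). (i + 1, j)) ` (F \<times> F)"
        unfolding x by (force simp: image_iff)
    qed
    then have "finite {x. (wmod w (Dop w ?a) x)\<^sup>2 \<noteq> 0}"
      by (rule finite_subset) (use F in auto)
    then show ?thesis
      unfolding HS_iff by (intro finite_nonzero_values_imp_summable_on) simp
  qed
  then have D: "?a \<in> DomD w"
    using hs_norm_restr(1)[OF F] by (simp add: DomD_def)
  have top: "eventually (\<lambda>k. k \<notin> F) at_top"
  proof -
    have "eventually (\<lambda>k. \<forall>i\<in>F. k \<noteq> i) at_top"
      using F by (intro eventually_ball_finite ballI) (auto intro: eventually_mono[OF eventually_gt_at_top])
    then show ?thesis by (rule eventually_mono) auto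
  qed
  have bot: "eventually (\<lambda>k. k \<notin> F) at_bot"
  proof -
    have "eventually (\<lambda>k. \<forall>i\<in>F. k \<noteq> i) at_bot"
    proof (intro eventually_ball_finite ballI F)
      show "eventually (\<lambda>k. k \<noteq> i) at_bot" for i :: int
        using eventually_le_at_bot[of "i - 1"] by (rule eventually_mono) auto
    qed
    then show ?thesis by (rule eventually_mono) auto
  qed
  have "r_plus ?a n = 0" for n
    by (intro r_plus_eq tendsto_eventually eventually_mono[OF top]) (simp add: restr_def)
  moreover have "r_minus ?a n = 0" for n
    by (intro r_minus_eq tendsto_eventually eventually_mono[OF bot]) (simp add: restr_def)
  ultimately show ?thesis
    using D by (simp add: dom_DMN_def RanP_plus_def RanP_minus_def ell2_def)
qed

text \<open>Finite matrices are dense, and they lie in the domain because all their boundary values vanish.\<close>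

lemma dense_domT: "densely_defined w domT"
proof -
  have "\<exists>y\<in>domT. y \<in> Metric_space.mball (HS w) (\<lambda>a b. hs_norm w (a - b)) a r" if a: "a \<in> HS w" and r: "0 < r" for a r
  proof -
    obtain F where "finite F" "hs_norm w (a - restr F a) < r"
      using restr_dense[OF a r] .
    then show ?thesis
      using restr_in_dom[of F a] a hs_norm_restr(1)[of F a]
      by (intro bexI[of _ "restr F a"]) (auto simp: Metric_space.in_mball[OF Metric_space_HS] dom_eq_domT)
  qed
  then show ?thesis
    unfolding densely_defined_def hs_top_def Metric_space.metric_closure_of[OF Metric_space_HS] by auto
qed

text \<open>If \<open>M + N + 1 \<ge> 0\<close> the second interval is empty, otherwise the first one.\<close>

lemma index_cylinder: "op_index w domT (Dop w) = M + N + 1"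
  unfolding index_T by simp

end

section \<open>Index and parametrix of the d-bar operator\<close>

lemma mapply_Sop: "mapply (Sop w) x = (\<lambda>i. of_real (sval w i) * x i)"
proof
  fix i
  show "mapply (Sop w) x i = of_real (sval w i) * x i"
    unfolding mapply_def Sop_eq_mdiag mdiag_def
    by (subst infsum_singleton_support[where i = i]) auto
qed

lemma sval_pos_of_positive_injective:
  assumes "positive_op (Sop w)" "injective_op (Sop w)"
  shows "0 < sval w k"
proof -
  define e :: "int \<Rightarrow> complex" where "e = (\<lambda>i. if i = k then 1 else 0)"
  have e: "e \<in> ell2" and z: "(\<lambda>_. 0) \<in> ell2"
    by (auto simp: ell2_def e_def intro!: finite_nonzero_values_imp_summable_on)
  have "ell2_inner e (mapply (Sop w) e) = of_real (sval w k)"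
    unfolding ell2_inner_def mapply_Sop
    by (subst infsum_singleton_support[where i = k]) (auto simp: e_def)
  then have "0 \<le> sval w k"
    using assms(1) e unfolding positive_op_def by (metis nonneg_Reals_of_real_iff)
  moreover have "sval w k \<noteq> 0"
  proof
    assume "sval w k = 0"
    then have "mapply (Sop w) e = mapply (Sop w) (\<lambda>_. 0)"
      by (auto simp: mapply_Sop e_def)
    then have "e = (\<lambda>_. 0)"
      using assms(2) e z unfolding injective_op_def by (auto dest: inj_onD)
    then show False
      by (auto simp: e_def fun_eq_iff split: if_splits)
  qed
  ultimately show ?thesis by simp
qed

theorem theorem6p2:
  fixes w :: "int \<Rightarrow> real" and M N :: int
  assumes "\<forall>k. w k > 0"
    and "bounded (range w)"
    and "\<exists>\<epsilon>>0. \<forall>k. w k \<ge> \<epsilon>"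
    and "positive_op (Sop w)"
    and "injective_op (Sop w)"
  shows "fredholm_op w (dom_DMN w M N) (Dop w) \<and>
    op_index w (dom_DMN w M N) (Dop w) = M + N + 1 \<and>
    (\<exists>Q. bounded_op w Q \<and>
      op_ker (HS w) Q = op_coker w (dom_DMN w M N) (Dop w) \<and>
      (\<forall>a\<in>HS w. Q a \<in> dom_DMN w M N \<and>
         Dop w (Q a) = a - orth_proj w (op_coker w (dom_DMN w M N) (Dop w)) a) \<and>
      (\<forall>a\<in>dom_DMN w M N.
         Q (Dop w a) = a - orth_proj w (op_ker (dom_DMN w M N) (Dop w)) a) \<and>
      compact_op w Q)"
proof -
  obtain \<epsilon> where eps: "0 < \<epsilon>" "\<And>k. \<epsilon> \<le> w k"
    using assms(3) by blast
  obtain c where c: "\<And>k. \<bar>w k\<bar> \<le> c"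
    using assms(2) by (auto simp: bounded_iff)
  interpret cylinder w \<epsilon> c M N
    using eps abs_le_D1[OF c] sval_pos_of_positive_injective[OF assms(4,5)] by unfold_locales
  show ?thesis
    unfolding dom_eq_domT using fredholm_T[OF dense_domT] index_cylinder Q_is_parametrix by blast
qed

end
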